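(* Let $X=N+A$ be a local submartingale of class $(\Sigma)$, with only negative jumps, such that $A_\infty=\infty$ almost surely. Let $\varphi:\mathbb{R}_+\to\mathbb{R}_+$ be a nonnegative integrable function and define the random variable $$S_\varphi=\sup_{t\ge0}\big(X_t-\varphi(A_t)\big).$$ Then, for all $a\ge0$, $$\mathbb{P}(S_\varphi>a)=1-\exp\left(-\int_0^\infty\frac{dx}{a+\varphi(x)}\right).$$
   Context: All processes are defined on a filtered probability space satisfying the usual conditions; "increasing" means nondecreasing. A nonnegative local submartingale $X$ with decomposition $X_t=N_t+A_t$ is of class $(\Sigma)$ if: (i) $(N_t)$ is a càdlàg local martingale with $N_0=0$; (ii) $(A_t)$ is a continuous adapted increasing process with $A_0=0$; (iii) the measure $(dA_t)$ is carried by the set $\{t: X_t=0\}$. "Only negative jumps" means $X_t-X_{t-}\le 0$ for all $t>0$ (continuous $X$ is allowed). $A_\infty=\lim_{t\to\infty}A_t$. Functions are Borel. Conventions: $1/0=\infty$, $\exp(-\infty)=0$. *)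

theory Defs
  imports "HOL-Probability.Probability"
begin

text \<open>
  Processes are functions \<open>X :: real \<Rightarrow> 'a \<Rightarrow> real\<close> that are only looked at for times \<open>t \<ge> 0\<close>.
  Filtrations are indexed by \<^typ>\<open>ennreal\<close>, i.e. by \<open>[0, \<infinity>]\<close>, so that the library's
  \<^const>\<open>stopping_time\<close> covers stopping times that may take the value \<open>\<infinity>\<close>.
  The \<open>\<sigma>\<close>-algebra at time \<open>\<infinity>\<close> can be any sub-\<open>\<sigma>\<close>-algebra of \<open>M\<close> containing
  all \<open>F t\<close> with \<open>t < \<infinity>\<close>; no notion below depends on its choice.
  Path properties, identities between processes included, are required almost surely.
\<close>

locale usual_filtered_space = prob_space M + complete_measure M + filtration "space M" F
  for M :: "'a measure" and F :: "ennreal \<Rightarrow> 'a measure" +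
  assumes subalgebra_F: "\<And>t. subalgebra M (F t)"
    and null_sets_F: "null_sets M \<subseteq> sets (F 0)"
    and right_continuous_F: "\<And>t. t < \<infinity> \<Longrightarrow> sets (F t) = (\<Inter>s\<in>{t<..}. sets (F s))"

definition adapted :: "(ennreal \<Rightarrow> 'a measure) \<Rightarrow> (real \<Rightarrow> 'a \<Rightarrow> real) \<Rightarrow> bool" where
  "adapted F X \<longleftrightarrow> (\<forall>t\<ge>0. X t \<in> borel_measurable (F (ennreal t)))"

definition martingale :: "'a measure \<Rightarrow> (ennreal \<Rightarrow> 'a measure) \<Rightarrow> (real \<Rightarrow> 'a \<Rightarrow> real) \<Rightarrow> bool" where
  "martingale M F X \<longleftrightarrow> adapted F X \<and> (\<forall>t\<ge>0. integrable M (X t)) \<and>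
     (\<forall>s t. 0 \<le> s \<longrightarrow> s \<le> t \<longrightarrow> (AE \<omega> in M. real_cond_exp M (F (ennreal s)) (X t) \<omega> = X s \<omega>))"

definition submartingale :: "'a measure \<Rightarrow> (ennreal \<Rightarrow> 'a measure) \<Rightarrow> (real \<Rightarrow> 'a \<Rightarrow> real) \<Rightarrow> bool" where
  "submartingale M F X \<longleftrightarrow> adapted F X \<and> (\<forall>t\<ge>0. integrable M (X t)) \<and>
     (\<forall>s t. 0 \<le> s \<longrightarrow> s \<le> t \<longrightarrow> (AE \<omega> in M. X s \<omega> \<le> real_cond_exp M (F (ennreal s)) (X t) \<omega>))"

definition stopped :: "(real \<Rightarrow> 'a \<Rightarrow> real) \<Rightarrow> ('a \<Rightarrow> ennreal) \<Rightarrow> real \<Rightarrow> 'a \<Rightarrow> real" where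
  "stopped X T t \<omega> = X (enn2real (min (ennreal t) (T \<omega>))) \<omega>"

text \<open>The initial value is subtracted, as is customary, so that it need not be integrable.\<close>

definition locally_in ::
  "((real \<Rightarrow> 'a \<Rightarrow> real) \<Rightarrow> bool) \<Rightarrow> 'a measure \<Rightarrow> (ennreal \<Rightarrow> 'a measure) \<Rightarrow> (real \<Rightarrow> 'a \<Rightarrow> real) \<Rightarrow> bool"
where
  "locally_in P M F X \<longleftrightarrow> (\<exists>T :: nat \<Rightarrow> 'a \<Rightarrow> ennreal.
     (\<forall>n. stopping_time F (T n)) \<and>
     (AE \<omega> in M. incseq (\<lambda>n. T n \<omega>) \<and> (\<lambda>n. T n \<omega>) \<longlonglongrightarrow> \<infinity>) \<and>
     (\<forall>n. P (\<lambda>t \<omega>. stopped X (T n) t \<omega> - X 0 \<omega>)))"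

definition local_martingale where
  "local_martingale M F X \<longleftrightarrow> adapted F X \<and> locally_in (martingale M F) M F X"

definition local_submartingale where
  "local_submartingale M F X \<longleftrightarrow> adapted F X \<and> locally_in (submartingale M F) M F X"

definition cadlag :: "(real \<Rightarrow> real) \<Rightarrow> bool" where
  "cadlag f \<longleftrightarrow> (\<forall>t\<ge>0. (f \<longlongrightarrow> f t) (at_right t)) \<and> (\<forall>t>0. \<exists>l. (f \<longlongrightarrow> l) (at_left t))"

text \<open>
  The measure \<open>dA\<^sub>t\<close> is the Stieltjes measure of the path; extending the path by its value at
  \<open>0\<close> to negative times gives no mass to \<open>(-\<infinity>, 0]\<close>.
\<close>

definition class_Sigma ::
  "'a measure \<Rightarrow> (ennreal \<Rightarrow> 'a measure) \<Rightarrow> (real \<Rightarrow> 'a \<Rightarrow> real) \<Rightarrow> (real \<Rightarrow> 'a \<Rightarrow> real) \<Rightarrow>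
    (real \<Rightarrow> 'a \<Rightarrow> real) \<Rightarrow> bool"
where
  "class_Sigma M F X N A \<longleftrightarrow>
     local_submartingale M F X \<and>
     (AE \<omega> in M. \<forall>t\<ge>0. 0 \<le> X t \<omega>) \<and>
     (AE \<omega> in M. \<forall>t\<ge>0. X t \<omega> = N t \<omega> + A t \<omega>) \<and>
     local_martingale M F N \<and>
     (AE \<omega> in M. cadlag (\<lambda>t. N t \<omega>) \<and> N 0 \<omega> = 0) \<and>
     adapted F A \<and>
     (AE \<omega> in M. continuous_on {0..} (\<lambda>t. A t \<omega>) \<and> mono_on {0..} (\<lambda>t. A t \<omega>) \<and> A 0 \<omega> = 0) \<and>
     (AE \<omega> in M. AE t in interval_measure (\<lambda>t. A (max 0 t) \<omega>). 0 \<le> t \<longrightarrow> X t \<omega> = 0)"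

definition only_negative_jumps :: "'a measure \<Rightarrow> (real \<Rightarrow> 'a \<Rightarrow> real) \<Rightarrow> bool" where
  "only_negative_jumps M X \<longleftrightarrow>
     (AE \<omega> in M. \<forall>t>0. X t \<omega> - Lim (at_left t) (\<lambda>s. X s \<omega>) \<le> 0)"

definition S_phi :: "(real \<Rightarrow> real) \<Rightarrow> (real \<Rightarrow> 'a \<Rightarrow> real) \<Rightarrow> (real \<Rightarrow> 'a \<Rightarrow> real) \<Rightarrow> 'a \<Rightarrow> ereal" where
  "S_phi \<phi> X A \<omega> = (SUP t\<in>{0..}. ereal (X t \<omega> - \<phi> (A t \<omega>)))"

text \<open>\<open>exp (-x)\<close> for \<open>x \<in> [0, \<infinity>]\<close>, with \<open>exp (-\<infinity>) = 0\<close>.\<close>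

definition exp_minus :: "ennreal \<Rightarrow> real" where
  "exp_minus x = (if x = \<infinity> then 0 else exp (- enn2real x))"

end

theory Submission
  imports Defs
begin

text \<open>
  Integrability of \<open>\<phi>\<close> forces \<open>\<integral> dx / (a + \<phi> x) = \<infinity>\<close>, so the claim is that \<open>S\<^sub>\<phi> = \<infinity>\<close> almost
  surely. Fix levels \<open>n, c > 0\<close> and let \<open>T\<close> be the first time with \<open>A \<ge> n\<close> and \<open>X > c\<close>, and
  \<open>\<sigma> v\<close> the first time with \<open>A \<ge> v\<close>. Since \<open>A\<close> only grows at zeros of \<open>X\<close> and \<open>X\<close> has no
  positive jumps, \<open>X\<close> vanishes at \<open>\<sigma> v\<close> and equals \<open>c\<close> at \<open>T\<close>. Stopping the local martingale
  \<open>N = X - A\<close> at \<open>\<sigma> n\<close> and at \<open>T \<and> \<sigma> v\<close> gives \<open>c \<cdot> P(T < \<sigma> v) = E[A (T \<and> \<sigma> v)] - n\<close>.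
  Hence \<open>T < \<infinity>\<close> almost surely, and the law of \<open>A T\<close> is dominated by \<open>1 / c\<close> times Lebesgue measure
  on \<open>[n, \<infinity>)\<close>. As \<open>B = {\<phi> > 1}\<close> has finite Lebesgue measure, \<open>P(A T \<in> B)\<close> tends to \<open>0\<close> as
  \<open>n\<close> grows, and off this event \<open>X - \<phi> A \<ge> c - 1\<close> at time \<open>T\<close>.
\<close>

section \<open>Deterministic analysis of one nonnegative path that has no upward jumps and is pushed
  up only at its zeros\<close>

section \<open>Paths\<close>

text \<open>Only rational times enter, so events about the debut of a process are countable
  combinations of events at fixed times. Nothing is lost for the conditions below: they persist on a
  right neighbourhood of some point near the true first time. The infimum over the empty set is
  infinity, which encodes that the condition never occurs.\<close>

definition debut :: "(real \<Rightarrow> bool) \<Rightarrow> ennreal" where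
  "debut P = (INF q\<in>{q\<in>\<rat>. 0 \<le> q \<and> P q}. ennreal q)"

lemma debut_le: "q \<in> \<rat> \<Longrightarrow> 0 \<le> q \<Longrightarrow> P q \<Longrightarrow> debut P \<le> ennreal q"
  unfolding debut_def by (auto intro!: INF_lower)

lemma le_debutI: "(\<And>q. q \<in> \<rat> \<Longrightarrow> 0 \<le> q \<Longrightarrow> P q \<Longrightarrow> t \<le> ennreal q) \<Longrightarrow> t \<le> debut P"
  unfolding debut_def by (auto intro!: INF_greatest)

lemma debut_less_iff: "debut P < t \<longleftrightarrow> (\<exists>q\<in>\<rat>. 0 \<le> q \<and> P q \<and> ennreal q < t)"
  unfolding debut_def by (auto simp: INF_less_iff)

lemma debut_antimono: "(\<And>q. Q q \<Longrightarrow> P q) \<Longrightarrow> debut P \<le> debut Q"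
  unfolding debut_def by (auto intro!: INF_superset_mono)

text \<open>Transfers an open condition from a real time to a slightly later rational one, where
  \<open>debut\<close> can see it.\<close>

lemma ex_rat_at_right:
  fixes f :: "real \<Rightarrow> real"
  assumes "(f \<longlongrightarrow> f r) (at_right r)" "f r \<in> U" "open U" "r < t"
  shows "\<exists>q\<in>\<rat>. r < q \<and> q < t \<and> f q \<in> U"
proof -
  have "eventually (\<lambda>y. f y \<in> U) (at_right r)"
    using assms by (auto simp: tendsto_def)
  then obtain b where b: "b > r" "\<And>y. r < y \<Longrightarrow> y < b \<Longrightarrow> f y \<in> U"
    by (auto simp: eventually_at_right_field)
  from \<open>b > r\<close> \<open>r < t\<close> obtain q where "q \<in> \<rat>" "r < q" "q < min b t"
    using Rats_dense_in_real[of r "min b t"] by auto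
  with b show ?thesis by auto
qed

text \<open>Fixing one outcome makes everything short of optional stopping deterministic;
  probability enters only through the fact that almost every path satisfies these axioms.\<close>

locale reflected_path =
  fixes x a :: "real \<Rightarrow> real"
  assumes x_nonneg: "0 \<le> t \<Longrightarrow> 0 \<le> x t"
    and x_right: "0 \<le> t \<Longrightarrow> (x \<longlongrightarrow> x t) (at_right t)"
    and x_left: "0 < t \<Longrightarrow> \<exists>l. (x \<longlongrightarrow> l) (at_left t)"
    and x_jump: "0 < t \<Longrightarrow> x t \<le> Lim (at_left t) x"
    and a_cont: "continuous_on {0..} a"
    and a_mono: "mono_on {0..} a"
    and a_0: "a 0 = 0"
    and a_top: "filterlim a at_top at_top"
    and carried: "AE t in interval_measure (\<lambda>t. a (max 0 t)). 0 \<le> t \<longrightarrow> x t = 0"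
begin

lemma a_le: "0 \<le> s \<Longrightarrow> s \<le> t \<Longrightarrow> a s \<le> a t"
  using a_mono by (auto simp: mono_on_def)

text \<open>The Stieltjes measure gives the interval the mass \<open>a t - a s > 0\<close>, so the
  interval cannot avoid the zero set that carries this measure.\<close>

lemma zero_between:
  assumes "0 \<le> s" "s < t" "a s < a t"
  shows "\<exists>r. s < r \<and> r \<le> t \<and> x r = 0"
proof (rule ccontr)
  assume *: "\<not> ?thesis"
  let ?F = "\<lambda>t. a (max 0 t)" and ?\<mu> = "interval_measure (\<lambda>t. a (max 0 t))"
  have cont: "continuous_on UNIV ?F"
    by (rule continuous_on_compose2[OF a_cont]) (auto intro!: continuous_intros)
  have "emeasure ?\<mu> {s<..t} = ennreal (?F t - ?F s)"
    using assms cont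
    by (intro emeasure_interval_measure_Ioc)
       (auto intro!: a_le simp: continuous_on_eq_continuous_at continuous_at_imp_continuous_at_within)
  moreover have "{s<..t} \<in> null_sets ?\<mu>"
  proof (rule AE_iff_null_sets[THEN iffD2])
    show "{s<..t} \<in> sets ?\<mu>" by simp
    show "AE r in ?\<mu>. r \<notin> {s<..t}"
      using carried by eventually_elim (use * assms in auto)
  qed
  ultimately show False
    using assms by (auto simp: null_sets_def ennreal_eq_0_iff max_def)
qed

text \<open>Zeros of \<open>x\<close> accumulate at \<open>t\<close> from the left, which forces the
  left limit to be 0. Without an upward jump \<open>x t\<close> is then at most 0, hence equal to
  0.\<close>

lemma x_zero_at_increase:
  assumes t: "0 < t" and inc: "\<And>s. 0 \<le> s \<Longrightarrow> s < t \<Longrightarrow> a s < a t"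
  shows "x t = 0"
proof -
  obtain l where l: "(x \<longlongrightarrow> l) (at_left t)" using x_left[OF t] by auto
  have "\<exists>r. s < r \<and> r < t \<and> x r = 0" if s: "0 \<le> s" "s < t" for s
  proof -
    have "(a \<longlongrightarrow> a t) (at_left t)"
      using continuous_on_interior[OF a_cont, of t] t
      by (simp add: continuous_at_imp_continuous_at_within continuous_within[symmetric])
    then have "eventually (\<lambda>r. a s < a r) (at_left t)"
      using inc[OF s] by (rule order_tendstoD)
    then obtain b where b: "b < t" "\<And>r. b < r \<Longrightarrow> r < t \<Longrightarrow> a s < a r"
      by (auto simp: eventually_at_left_field)
    \<comment> \<open>The interval given to \<open>zero_between\<close> has to end strictly before
      \<open>t\<close>, since a zero at \<open>t\<close> itself would say nothing about the left
      limit; beyond \<open>b\<close> the path \<open>a\<close> already exceeds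
      \<open>a s\<close>.\<close>
    define r where "r = (max s b + t) / 2"
    have "s < r" "r < t" "b < r" using s b by (auto simp: r_def)
    then show ?thesis
      using zero_between[of s r] b(2)[of r] s by fastforce
  qed
  note zero = this
  have "l = 0"
  proof (rule ccontr)
    assume "l \<noteq> 0"
    then have "eventually (\<lambda>r. x r \<noteq> 0) (at_left t)"
      using l by (rule tendsto_imp_eventually_ne[rotated])
    then obtain b where b: "b < t" "\<And>r. b < r \<Longrightarrow> r < t \<Longrightarrow> x r \<noteq> 0"
      by (auto simp: eventually_at_left_field)
    then show False using zero[of "max 0 b"] t by auto
  qed
  then have "Lim (at_left t) x = 0" using l by (auto intro: tendsto_Lim)
  then show ?thesis using x_jump[OF t] x_nonneg[of t] t by auto
qed

text \<open>By continuity the set where \<open>a\<close> is at least \<open>v\<close> is closed and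
  its least element \<open>s\<close> satisfies \<open>a s = v\<close>. All earlier values of
  \<open>a\<close> are smaller, so \<open>x s = 0\<close> by \<open>x_zero_at_increase\<close>. The
  final equivalence later turns comparisons of values of \<open>a\<close> into comparisons of
  times.\<close>

lemma level_time:
  assumes v: "0 < v"
  obtains s where "0 < s" "debut (\<lambda>q. v \<le> a q) = ennreal s" "a s = v" "x s = 0"
    "\<And>r. 0 \<le> r \<Longrightarrow> v \<le> a r \<longleftrightarrow> s \<le> r"
proof -
  let ?L = "{t\<in>{0..}. v \<le> a t}"
  define s where "s = Inf ?L"
  have "closed ?L"
    by (rule continuous_on_closed_Collect_le[OF _ a_cont]) auto
  moreover have "?L \<noteq> {}"
  proof -
    have "eventually (\<lambda>t. v \<le> a t \<and> 0 \<le> t) at_top"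
      using a_top eventually_ge_at_top[of 0] by (auto simp: filterlim_at_top intro: eventually_conj)
    then obtain t where "v \<le> a t" "0 \<le> t"
      using eventually_happens'[of "at_top :: real filter"] by auto
    then show ?thesis by auto
  qed
  moreover have bdd: "bdd_below ?L" by (auto intro!: bdd_belowI[of _ 0])
  ultimately have sL: "s \<in> ?L" unfolding s_def by (intro closed_contains_Inf)
  have s_le: "s \<le> r" if "0 \<le> r" "v \<le> a r" for r
    unfolding s_def using that bdd by (intro cInf_lower) auto
  obtain r where r: "0 \<le> r" "r \<le> s" "a r = v"
    using IVT'[of a 0 v s] v sL a_0 continuous_on_subset[OF a_cont, of "{0..s}"] by auto
  then have as: "a s = v" using s_le[of r] by auto
  have s0: "0 < s" using sL as v a_0 by (cases "s = 0") auto
  have iff: "v \<le> a r \<longleftrightarrow> s \<le> r" if "0 \<le> r" for r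
    using s_le[OF that] a_le[of s r] sL as by auto
  have "a r < a s" if "0 \<le> r" "r < s" for r
    using iff[OF that(1)] that as by auto
  then have "x s = 0" using s0 by (intro x_zero_at_increase) auto
  moreover have "debut (\<lambda>q. v \<le> a q) = ennreal s"
  proof (rule antisym)
    show "ennreal s \<le> debut (\<lambda>q. v \<le> a q)"
      by (rule le_debutI) (auto simp: iff ennreal_leI)
    show "debut (\<lambda>q. v \<le> a q) \<le> ennreal s"
    \<comment> \<open>The time \<open>s\<close> may be irrational, but every rational just after it
      satisfies the condition.\<close>
    proof (rule ennreal_le_epsilon)
      fix e :: real assume "0 < e"
      then obtain q where q: "q \<in> \<rat>" "s < q" "q < s + e"
        using Rats_dense_in_real[of s "s + e"] by auto
      then have "debut (\<lambda>q. v \<le> a q) \<le> ennreal q"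
        using s0 by (intro debut_le) (auto simp: iff)
      also have "\<dots> \<le> ennreal (s + e)" using q by (intro ennreal_leI) auto
      finally show "debut (\<lambda>q. v \<le> a q) \<le> ennreal s + ennreal e"
        using s0 \<open>0 < e\<close> by (simp add: ennreal_plus)
    qed
  qed
  ultimately show ?thesis using that s0 as iff by blast
qed

abbreviation level :: "real \<Rightarrow> ennreal" where
  "level v \<equiv> debut (\<lambda>q. v \<le> a q)"

abbreviation hit :: "real \<Rightarrow> real \<Rightarrow> ennreal" where
  "hit n c \<equiv> debut (\<lambda>q. n \<le> a q \<and> c < x q)"

text \<open>If \<open>x r > c\<close>, right-continuity yields a rational time before
  \<open>hit n c\<close> at which the hitting condition holds, against the definition of the
  infimum.\<close>

lemma x_le_before_hit:
  assumes "0 \<le> r" "n \<le> a r" "ennreal r < hit n c"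
  shows "x r \<le> c"
proof (rule ccontr)
  assume "\<not> x r \<le> c"
  \<comment> \<open>A real bound is needed to confine the rational time, also when
    \<open>hit n c\<close> is infinite.\<close>
  obtain t where t: "r < t" "ennreal t \<le> hit n c"
  proof (cases "hit n c")
    case (real h)
    then show ?thesis using that[of h] assms by (auto simp: ennreal_less_iff)
  next
    case top
    then show ?thesis using that[of "r + 1"] by auto
  qed
  from x_right[OF assms(1)] \<open>\<not> x r \<le> c\<close> t(1)
  obtain q where q: "q \<in> \<rat>" "r < q" "q < t" "c < x q"
    using ex_rat_at_right[of x r "{c<..}" t] by auto
  have "n \<le> a q" using a_le[of r q] assms q by auto
  then have "hit n c \<le> ennreal q" using q assms by (intro debut_le) auto
  also have "\<dots> < ennreal t" using q assms by (auto simp: ennreal_less_iff)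
  finally show False using t by auto
qed

text \<open>There is no overshoot: right-continuity gives \<open>x h \<ge> c\<close>, while the left
  limit is at most \<open>c\<close> and an upward jump is excluded.\<close>

lemma hit_values:
  assumes n: "0 < n" and c: "0 < c" and h: "hit n c = ennreal h" "0 \<le> h"
  shows "n \<le> a h" "x h = c"
proof -
  obtain s where s: "0 < s" "level n = ennreal s" "x s = 0" "\<And>r. 0 \<le> r \<Longrightarrow> n \<le> a r \<longleftrightarrow> s \<le> r"
    using level_time[OF n] by metis
  have "ennreal s \<le> ennreal h"
    unfolding s(2)[symmetric] h(1)[symmetric] by (rule debut_antimono) auto
  then have sh: "s \<le> h" using h by simp
  then show "n \<le> a h" using s h by auto
  have ge: "c \<le> x h"
  proof (rule ccontr)
    assume "\<not> c \<le> x h"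
    then have "eventually (\<lambda>r. x r < c) (at_right h)"
      using x_right[OF h(2)] by (intro order_tendstoD) auto
    then obtain b where b: "h < b" "\<And>r. h < r \<Longrightarrow> r < b \<Longrightarrow> x r < c"
      by (auto simp: eventually_at_right_field)
    have "hit n c < ennreal b" using h b by (auto simp: ennreal_less_iff)
    then obtain q where q: "0 \<le> q" "n \<le> a q" "c < x q" "ennreal q < ennreal b" "q \<in> \<rat>"
      by (auto simp: debut_less_iff)
    then have "ennreal h \<le> ennreal q" unfolding h(1)[symmetric] by (intro debut_le) auto
    then have "h \<le> q" using q(1) by simp
    moreover have "q < b" using q by (simp add: ennreal_less_iff)
    ultimately show False using b(2)[of q] q(3) \<open>\<not> c \<le> x h\<close> by (cases "q = h") auto
  qed
  \<comment> \<open>This leaves a left neighbourhood of \<open>h\<close> on which \<open>a\<close>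
    is already at least \<open>n\<close>, so that \<open>x_le_before_hit\<close> bounds
    \<open>x\<close> there.\<close>
  have "s \<noteq> h" using ge c s by auto
  then have "s < h" using sh by auto
  obtain l where l: "(x \<longlongrightarrow> l) (at_left h)" using x_left[of h] \<open>s < h\<close> s(1) by auto
  have "eventually (\<lambda>r. x r \<le> c) (at_left h)"
  proof -
    have "x r \<le> c" if "s < r" "r < h" for r
      using that s h by (intro x_le_before_hit[of r n c]) (auto simp: ennreal_less_iff)
    then show ?thesis using \<open>s < h\<close> by (auto simp: eventually_at_left_field)
  qed
  then have "l \<le> c" using l by (intro tendsto_upperbound[of x l "at_left h"]) auto
  moreover have "Lim (at_left h) x = l" using l by (auto intro: tendsto_Lim)
  ultimately show "x h = c" using x_jump[of h] \<open>s < h\<close> s(1) ge by auto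
qed

text \<open>Whichever of the two times comes first decides the value of \<open>x\<close> at the
  stop: \<open>c\<close> by \<open>hit_values\<close>, or 0 by \<open>level_time\<close>. Before the
  stop, \<open>a\<close> is at least \<open>n\<close> from \<open>s\<close> on and the hit has not
  occurred, so \<open>x\<close> is at most \<open>c\<close>.\<close>

lemma stop_time:
  assumes n: "0 < n" and c: "0 < c" and v: "n \<le> v"
  obtains s r where "0 < s" "s \<le> r" "level n = ennreal s" "min (hit n c) (level v) = ennreal r"
    "a s = n" "x s = 0" "n \<le> a r" "a r \<le> v"
    "x r = (if hit n c < level v then c else 0)"
    "\<not> hit n c < level v \<longrightarrow> a r = v"
    "\<forall>p. s \<le> p \<and> p < r \<longrightarrow> x p \<le> c"
proof -
  obtain s where s: "0 < s" "level n = ennreal s" "a s = n" "x s = 0" "\<And>r. 0 \<le> r \<Longrightarrow> n \<le> a r \<longleftrightarrow> s \<le> r"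
    using level_time[OF n] by metis
  obtain w where w: "0 < w" "level v = ennreal w" "a w = v" "x w = 0" "\<And>r. 0 \<le> r \<Longrightarrow> v \<le> a r \<longleftrightarrow> w \<le> r"
    using level_time[of v] n v by (metis less_le_trans)
  have sw: "s \<le> w" using s(5)[of w] w(1,3) v by simp
  show ?thesis
  proof (cases "hit n c < level v")
    case True
    then obtain h where h: "hit n c = ennreal h" "0 \<le> h" by (cases "hit n c") auto
    have val: "n \<le> a h" "x h = c" using hit_values[OF n c h] by blast+
    have hw: "h < w" using True h(2) w(1) unfolding h(1) w(2) by (simp add: ennreal_less_iff)
    have 1: "s \<le> h" using s(5)[OF h(2)] val(1) by blast
    have 2: "min (hit n c) (level v) = ennreal h"
      unfolding min_absorb1[OF less_imp_le[OF True]] by (rule h(1))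
    have 3: "a h \<le> v" using a_le[of h w] w(3) h(2) hw by simp
    have 4: "x h = (if hit n c < level v then c else 0)"
      using val(2) True by (simp only: if_True)
    have 5: "x p \<le> c" if "s \<le> p" "p < h" for p
    proof (rule x_le_before_hit[where n = n])
      show p: "0 \<le> p" using that s(1) by simp
      show "n \<le> a p" using s(5)[OF p] that(1) by blast
      show "ennreal p < hit n c" unfolding h(1) using p that(2) by (simp add: ennreal_less_iff)
    qed
    show ?thesis using that[OF s(1) 1 s(2) 2 s(3,4) val(1) 3 4] 5 True by blast
  next
    case False
    have 2: "min (hit n c) (level v) = ennreal w"
      unfolding w(2)[symmetric] using False by (intro min_absorb2) (simp only: not_less)
    have 3: "n \<le> a w" "a w \<le> v" using w(3) v by simp_all
    have 4: "x w = (if hit n c < level v then c else 0)"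
      using w(4) False by (simp only: if_False)
    have 5: "x p \<le> c" if "s \<le> p" "p < w" for p
    proof (rule x_le_before_hit[where n = n])
      show p: "0 \<le> p" using that s(1) by simp
      show "n \<le> a p" using s(5)[OF p] that(1) by blast
      have "ennreal p < level v"
        unfolding w(2) using p that(2) by (simp add: ennreal_less_iff)
      then show "ennreal p < hit n c" using False by (meson less_le_trans not_less)
    qed
    show ?thesis using that[OF s(1) sw s(2) 2 s(3,4) 3 4] 5 w(3) by blast
  qed
qed

lemma enn2real_min: "0 \<le> p \<Longrightarrow> 0 \<le> q \<Longrightarrow> enn2real (min (ennreal p) (ennreal q)) = min p q"
  by (simp add: min_def)

text \<open>The bound does not depend on \<open>p\<close>, which will be a localising time, so it
  serves as a dominating constant. For \<open>p\<close> beyond \<open>s\<close> the increment is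
  \<open>x q - (a q - n)\<close> with \<open>x q\<close> in [0, c] and \<open>a q - n\<close> in
  [0, v - n].\<close>

lemma increment_bound:
  assumes n: "0 < n" and c: "0 < c" and v: "n \<le> v" and p: "0 \<le> p"
    and N: "\<And>t. 0 \<le> t \<Longrightarrow> N t = x t - a t"
  shows "\<bar>N (enn2real (min (ennreal p) (min (hit n c) (level v))))
      - N (enn2real (min (ennreal p) (level n)))\<bar> \<le> c + (v - n)"
proof -
  obtain s r where sr: "0 < s" "s \<le> r" "level n = ennreal s" "min (hit n c) (level v) = ennreal r"
    "a s = n" "x s = 0" "n \<le> a r" "a r \<le> v"
    "x r = (if hit n c < level v then c else 0)"
    "\<not> hit n c < level v \<longrightarrow> a r = v"
    "\<forall>p. s \<le> p \<and> p < r \<longrightarrow> x p \<le> c"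
    using stop_time[OF n c v] by blast
  show ?thesis
  proof (cases "p \<le> s")
    case True
    then have "min p r = p" "min p s = p" using sr by simp_all
    then show ?thesis unfolding sr(3,4) using sr(1,2) p c v by (simp add: enn2real_min)
  next
    case False
    define q where "q = min p r"
    have q: "s \<le> q" "q \<le> r" using False sr by (auto simp: q_def)
    \<comment> \<open>Strictly before \<open>r\<close> the level has not been exceeded; at
      \<open>r\<close> the value is \<open>c\<close> or 0.\<close>
    have "x q \<le> c" using sr(11) sr(9) q c by (cases "q = r") auto
    moreover have "0 \<le> x q" using q sr by (intro x_nonneg) auto
    moreover have "n \<le> a q" "a q \<le> v" using a_le[of s q] a_le[of q r] q sr by auto
    ultimately show ?thesis
      unfolding sr(3,4) using sr(1,2,5,6) p False q N[of q] N[of s]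
      by (simp add: enn2real_min min_absorb2 q_def[symmetric])
  qed
qed

text \<open>Once \<open>p\<close> has passed the stop, the increment no longer depends on
  \<open>p\<close>. This identifies the limit when the localisation is removed.\<close>

lemma increment_eq:
  assumes n: "0 < n" and c: "0 < c" and v: "n \<le> v" and p: "0 \<le> p"
    and N: "\<And>t. 0 \<le> t \<Longrightarrow> N t = x t - a t"
    and "min (hit n c) (level v) \<le> ennreal p"
  shows "N (enn2real (min (ennreal p) (min (hit n c) (level v))))
      - N (enn2real (min (ennreal p) (level n)))
    = (if hit n c < level v then c else 0) - (a (enn2real (min (hit n c) (level v))) - n)"
proof -
  obtain s r where sr: "0 < s" "s \<le> r" "level n = ennreal s" "min (hit n c) (level v) = ennreal r"
    "a s = n" "x s = 0" "n \<le> a r" "a r \<le> v"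
    "x r = (if hit n c < level v then c else 0)"
    "\<not> hit n c < level v \<longrightarrow> a r = v"
    "\<forall>p. s \<le> p \<and> p < r \<longrightarrow> x p \<le> c"
    using stop_time[OF n c v] by blast
  then have "r \<le> p" using assms(6) p by simp
  then show ?thesis unfolding sr(3,4,9)[symmetric] using sr(1-6) p N[of r] N[of s]
    by (simp add: enn2real_min min_absorb2)
qed

lemma stop_level_bounds:
  assumes n: "0 < n" and c: "0 < c" and v: "n \<le> v"
  shows "n \<le> a (enn2real (min (hit n c) (level v)))" "a (enn2real (min (hit n c) (level v))) \<le> v"
    "\<not> hit n c < level v \<Longrightarrow> a (enn2real (min (hit n c) (level v))) = v"
    "min (hit n c) (level v) < \<infinity>"
proof -
  obtain s r where sr: "0 < s" "s \<le> r" "level n = ennreal s" "min (hit n c) (level v) = ennreal r"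
    "a s = n" "x s = 0" "n \<le> a r" "a r \<le> v"
    "x r = (if hit n c < level v then c else 0)"
    "\<not> hit n c < level v \<longrightarrow> a r = v"
    "\<forall>p. s \<le> p \<and> p < r \<longrightarrow> x p \<le> c"
    using stop_time[OF n c v] by blast
  have [simp]: "enn2real (ennreal r) = r" using sr(1,2) by simp
  show "n \<le> a (enn2real (min (hit n c) (level v)))" "a (enn2real (min (hit n c) (level v))) \<le> v"
    "\<not> hit n c < level v \<Longrightarrow> a (enn2real (min (hit n c) (level v))) = v"
    "min (hit n c) (level v) < \<infinity>"
    unfolding sr(4) using sr(7,8,10) by simp_all
qed

text \<open>Expresses the distribution function of \<open>a\<close> at the hitting time through an
  order relation between two stopping times.\<close>

lemma hit_less_level_iff:
  assumes n: "0 < n" and c: "0 < c" and v: "0 < v" and h: "hit n c < \<infinity>"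
  shows "hit n c < level v \<longleftrightarrow> a (enn2real (hit n c)) < v"
proof -
  obtain w where w: "0 < w" "level v = ennreal w" "\<And>r. 0 \<le> r \<Longrightarrow> v \<le> a r \<longleftrightarrow> w \<le> r"
    using level_time[OF v] by metis
  from h obtain h' where "hit n c = ennreal h'" "0 \<le> h'" by (cases "hit n c") auto
  then show ?thesis using w by (auto simp: ennreal_less_iff not_le[symmetric])
qed

text \<open>If the hit precedes \<open>level u\<close>, both stops coincide. Otherwise
  \<open>a\<close> equals \<open>u\<close> at the first stop and is at most \<open>v\<close> at the
  second. This Lipschitz bound is the source of the density bound for the law of \<open>A\<close> at
  the hitting time.\<close>

lemma stop_level_diff:
  assumes n: "0 < n" and c: "0 < c" and u: "n \<le> u" and v: "u \<le> v"
  shows "a (enn2real (min (hit n c) (level v))) - a (enn2real (min (hit n c) (level u))) \<le> v - u"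
proof (cases "hit n c < level u")
  case True
  moreover have "level u \<le> level v" using v by (intro debut_antimono) auto
  ultimately show ?thesis using v by (simp add: min_absorb1 less_imp_le[OF less_le_trans] less_imp_le)
next
  case False
  then show ?thesis
    using stop_level_bounds(3)[OF n c u] stop_level_bounds(2)[OF n c, of v] u v by simp
qed

end

section \<open>Completeness, domination by Lebesgue measure, and a Vitali convergence
  theorem\<close>

section \<open>Measure theory\<close>

text \<open>Path properties hold only almost surely, so \<open>A\<close> at a random time and the
  final supremum are recognised as measurable by comparison with a measurable function off a null
  set.\<close>

lemma (in complete_measure) measurable_AE_cong:
  assumes "g \<in> M \<rightarrow>\<^sub>M N" "AE x in M. f x = g x" "\<And>x. x \<in> space M \<Longrightarrow> f x \<in> space N"
  shows "f \<in> M \<rightarrow>\<^sub>M N"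
proof (rule measurableI)
  fix A assume A: "A \<in> sets N"
  have 1: "g -` A \<inter> space M \<in> sets M" using assms(1) A by (rule measurable_sets)
  have 2: "AE x in M. x \<in> g -` A \<inter> space M \<longleftrightarrow> x \<in> f -` A \<inter> space M"
    using assms(2) by eventually_elim auto
  show "f -` A \<inter> space M \<in> sets M" by (rule in_sets_AE[OF 2 1]) auto
qed (use assms in auto)

text \<open>Open sets are increasing unions of dyadic intervals, and Lebesgue measure is outer regular.\<close>

lemma emeasure_le_lborel:
  fixes \<mu> :: "real measure"
  assumes sets: "sets \<mu> = sets borel"
    and le: "\<And>u v. u < v \<Longrightarrow> emeasure \<mu> {u..<v} \<le> ennreal (k * (v - u))"
    and k: "0 < k" and B: "B \<in> sets borel"
  shows "emeasure \<mu> B \<le> ennreal k * emeasure lborel B"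
proof -
  have op: "emeasure \<mu> U \<le> ennreal k * emeasure lborel U" if U: "open U" for U
  proof -
    define d where "d j x = \<lfloor>x * 2 ^ j\<rfloor>" for j :: nat and x :: real
    \<comment> \<open>The union of all dyadic cells of length \<open>2 ^ -j\<close> that lie inside
      \<open>U\<close>; \<open>K j\<close> indexes these cells. There may be infinitely many, hence
      the integrals over \<open>count_space\<close>.\<close>
    define U' where "U' j = {x. \<forall>y. d j y = d j x \<longrightarrow> y \<in> U}" for j
    define K where "K j = {i. \<forall>y. d j y = i \<longrightarrow> y \<in> U}" for j
    have cell: "{x. d j x = i} = {i / 2 ^ j ..< (i + 1) / 2 ^ j}" for i :: int and j
      by (auto simp: d_def floor_eq_iff field_simps)
    \<comment> \<open>Each cell of level \<open>j + 1\<close> lies inside one cell of level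
      \<open>j\<close>, which makes \<open>U'\<close> increasing.\<close>
    have d_half: "d j x = d (Suc j) x div 2" for j x
      using floor_divide_real_eq_div[of 2 "x * 2 ^ Suc j"] by (simp add: d_def)
    have U'_UN: "U' j = (\<Union>i\<in>K j. {x. d j x = i})" for j
      by (auto simp: U'_def K_def)
    have disj: "disjoint_family_on (\<lambda>i. {x. d j x = i}) (K j)" for j
      by (auto simp: disjoint_family_on_def)
    have cells: "{x. d j x = i} \<in> sets borel" for i j unfolding cell by simp
    have *: "emeasure \<mu> (U' j) \<le> ennreal k * emeasure lborel (U' j)" for j
    proof -
      have "emeasure \<mu> (U' j) = (\<integral>\<^sup>+i. emeasure \<mu> {x. d j x = i} \<partial>count_space (K j))"
        unfolding U'_UN by (rule emeasure_UN_countable) (use disj cells sets in auto)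
      also have "\<dots> \<le> (\<integral>\<^sup>+i. ennreal k * emeasure lborel {x. d j x = i} \<partial>count_space (K j))"
      proof (rule nn_integral_mono)
        fix i :: int
        have "i / 2 ^ j < (i + 1) / (2 ^ j :: real)" by (simp add: field_simps)
        from le[OF this] show "emeasure \<mu> {x. d j x = i} \<le> ennreal k * emeasure lborel {x. d j x = i}"
          unfolding cell using k by (simp add: ennreal_mult'[symmetric] field_simps)
      qed
      also have "\<dots> = ennreal k * (\<integral>\<^sup>+i. emeasure lborel {x. d j x = i} \<partial>count_space (K j))"
        by (rule nn_integral_cmult) simp
      also have "(\<integral>\<^sup>+i. emeasure lborel {x. d j x = i} \<partial>count_space (K j)) = emeasure lborel (U' j)"
        unfolding U'_UN by (rule emeasure_UN_countable[symmetric]) (use disj cells in auto)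
      finally show ?thesis .
    qed
    have inc: "incseq U'"
    proof (rule incseq_SucI, rule subsetI)
      fix j x assume "x \<in> U' j"
      moreover have "d j y = d j x" if "d (Suc j) y = d (Suc j) x" for y
        unfolding d_half[of j] that ..
      ultimately show "x \<in> U' (Suc j)" unfolding U'_def by blast
    qed
    have U'_sets: "U' j \<in> sets borel" for j
      unfolding U'_UN using cells by (intro sets.countable_UN'') auto
    have Un: "(\<Union>j. U' j) = U"
    proof (intro antisym subsetI)
      fix x assume "x \<in> U"
      then obtain e where e: "e > 0" "\<And>y. dist y x < e \<Longrightarrow> y \<in> U"
        using U by (auto simp: open_dist)
      obtain j where j: "(1/2) ^ j < e" using real_arch_pow_inv[of e "1/2"] e by auto
      have "x \<in> U' j"
      proof -
        have "dist y x < e" if "d j y = d j x" for y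
        proof -
          have "\<bar>y * 2 ^ j - x * 2 ^ j\<bar> < 1"
            using that unfolding d_def by linarith
          then have "\<bar>y - x\<bar> * 2 ^ j < 1" by (simp add: abs_mult left_diff_distrib[symmetric])
          then have "\<bar>y - x\<bar> < (1/2) ^ j" by (simp add: field_simps power_one_over)
          then show ?thesis using j by (simp add: dist_real_def)
        qed
        then show ?thesis using e by (auto simp: U'_def)
      qed
      then show "x \<in> (\<Union>j. U' j)" by auto
    qed (auto simp: U'_def)
    have "(\<lambda>j. emeasure \<mu> (U' j)) \<longlonglongrightarrow> emeasure \<mu> U"
      unfolding Un[symmetric] using U'_sets sets inc by (intro Lim_emeasure_incseq) auto
    moreover have "emeasure \<mu> (U' j) \<le> ennreal k * emeasure lborel U" for j
    proof -
      have "emeasure lborel (U' j) \<le> emeasure lborel U"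
        using U by (intro emeasure_mono) (auto simp: Un[symmetric])
      then show ?thesis using *[of j] by (meson mult_left_mono order_trans zero_le)
    qed
    ultimately show ?thesis by (intro LIMSEQ_le_const2) auto
  qed
  show ?thesis
  proof (rule ennreal_le_epsilon)
    fix e :: real assume e: "0 < e"
    obtain U where U: "open U" "B \<subseteq> U" "emeasure lborel (U - B) < ennreal (e / k)"
      using outer_regular_lborel[OF B, of "e / k"] e k by auto
    have "emeasure \<mu> B \<le> emeasure \<mu> U" using U sets by (intro emeasure_mono) auto
    also have "\<dots> \<le> ennreal k * emeasure lborel U" by (rule op[OF U(1)])
    also have "emeasure lborel U = emeasure lborel B + emeasure lborel (U - B)"
      using U B by (subst plus_emeasure) (auto simp: Un_absorb1)
    also have "ennreal k * \<dots> \<le> ennreal k * (emeasure lborel B + ennreal (e / k))"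
      using U(3) by (intro mult_left_mono add_left_mono) auto
    also have "\<dots> = ennreal k * emeasure lborel B + ennreal e"
      using k e by (simp add: distrib_left ennreal_mult'[symmetric])
    finally show "emeasure \<mu> B \<le> ennreal k * emeasure lborel B + ennreal e" .
  qed
qed

text \<open>A form of Vitali's theorem: domination of the tails by those of one integrable function
  \<open>g\<close> is uniform integrability of the sequence. Fatou's lemma passes the tail bounds to
  the limit, the case \<open>K = 0\<close> giving integrability, and the truncated variables
  converge by bounded convergence.\<close>

lemma (in finite_measure) integral_tendsto_of_uniform_tails:
  fixes Z :: "nat \<Rightarrow> 'a \<Rightarrow> real"
  assumes Z: "\<And>k. integrable M (Z k)" and g: "integrable M g" and Y: "Y \<in> borel_measurable M"
    and tail: "\<And>k K. 0 \<le> K \<Longrightarrow> (\<integral>x. max 0 (\<bar>Z k x\<bar> - K) \<partial>M) \<le> (\<integral>x. max 0 (\<bar>g x\<bar> - K) \<partial>M)"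
    and lim: "AE x in M. (\<lambda>k. Z k x) \<longlonglongrightarrow> Y x"
  shows "integrable M Y" "(\<lambda>k. \<integral>x. Z k x \<partial>M) \<longlonglongrightarrow> (\<integral>x. Y x \<partial>M)"
proof -
  have [measurable]: "Z k \<in> borel_measurable M" "g \<in> borel_measurable M" for k
    using Z g by auto
  note Y[measurable]
  define h where "h K z = max 0 (\<bar>z\<bar> - K)" for K z :: real
  have h_meas[measurable]: "h K \<in> borel_measurable borel" for K
    unfolding h_def by measurable
  have h_int: "integrable M (\<lambda>x. h K (f x))" if "integrable M f" "0 \<le> K" for f K
    by (rule Bochner_Integration.integrable_bound[OF that(1)])
       (use that in \<open>auto simp: h_def\<close>)
  define r where "r K = (\<integral>x. h K (g x) \<partial>M)" for K
  have nn: "(\<integral>\<^sup>+x. ennreal (h K (Y x)) \<partial>M) \<le> ennreal (r K)" if K: "0 \<le> K" for K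
  proof -
    have "(\<integral>\<^sup>+x. ennreal (h K (Y x)) \<partial>M) = (\<integral>\<^sup>+x. liminf (\<lambda>k. ennreal (h K (Z k x))) \<partial>M)"
    proof (rule nn_integral_cong_AE)
      show "AE x in M. ennreal (h K (Y x)) = liminf (\<lambda>k. ennreal (h K (Z k x)))"
        using lim
      proof eventually_elim
        case (elim x)
        then have "(\<lambda>k. ennreal (h K (Z k x))) \<longlonglongrightarrow> ennreal (h K (Y x))"
          unfolding h_def by (intro tendsto_intros)
        then show ?case by (intro lim_imp_Liminf[symmetric]) auto
      qed
    qed
    also have "\<dots> \<le> liminf (\<lambda>k. \<integral>\<^sup>+x. ennreal (h K (Z k x)) \<partial>M)"
      by (rule nn_integral_liminf) simp
    also have "\<dots> \<le> liminf (\<lambda>k. ennreal (r K))"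
    proof (rule Liminf_mono, rule always_eventually, rule allI)
      fix k
      have "(\<integral>\<^sup>+x. ennreal (h K (Z k x)) \<partial>M) = ennreal (\<integral>x. h K (Z k x) \<partial>M)"
        by (rule nn_integral_eq_integral) (use h_int[OF Z K] in \<open>auto simp: h_def\<close>)
      also have "\<dots> \<le> ennreal (r K)"
        using tail[OF K] by (intro ennreal_leI) (simp add: r_def h_def)
      finally show "(\<integral>\<^sup>+x. ennreal (h K (Z k x)) \<partial>M) \<le> ennreal (r K)" .
    qed
    also have "\<dots> = ennreal (r K)" by (rule Liminf_const) simp
    finally show ?thesis .
  qed
  show Yint: "integrable M Y"
  proof (rule integrableI_bounded)
    have "(\<integral>\<^sup>+x. ennreal (norm (Y x)) \<partial>M) \<le> ennreal (r 0)"
      using nn[of 0] by (simp add: h_def)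
    then show "(\<integral>\<^sup>+x. ennreal (norm (Y x)) \<partial>M) < \<infinity>"
      by (rule le_less_trans) simp
  qed simp
  have tailY: "(\<integral>x. h K (Y x) \<partial>M) \<le> r K" if K: "0 \<le> K" for K
  proof -
    have "ennreal (\<integral>x. h K (Y x) \<partial>M) \<le> ennreal (r K)"
      using nn[OF K] by (subst nn_integral_eq_integral[symmetric])
        (use h_int[OF Yint K] in \<open>auto simp: h_def\<close>)
    moreover have "0 \<le> r K" by (auto simp: r_def h_def intro!: integral_nonneg)
    ultimately show ?thesis by simp
  qed
  have r_lim: "(\<lambda>n. r (real n)) \<longlonglongrightarrow> (\<integral>x. 0 \<partial>M)"
    unfolding r_def
  proof (rule integral_dominated_convergence[where w = "\<lambda>x. \<bar>g x\<bar>"])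
    show "AE x in M. (\<lambda>n. h (real n) (g x)) \<longlonglongrightarrow> 0"
    proof (rule AE_I2)
      fix x
      have "eventually (\<lambda>n. h (real n) (g x) = 0) sequentially"
        using eventually_ge_at_top[of "nat \<lceil>\<bar>g x\<bar>\<rceil>"]
      proof eventually_elim
        case (elim n)
        then have "\<bar>g x\<bar> \<le> real n" by linarith
        then show ?case by (simp add: h_def)
      qed
      then show "(\<lambda>n. h (real n) (g x)) \<longlonglongrightarrow> 0"
        by (simp add: tendsto_eventually)
    qed
  qed (use g in \<open>auto simp: h_def\<close>)
  \<comment> \<open>Clamping to [-K, K]; the error is exactly the excess
    \<open>h K z\<close>.\<close>
  define cl where "cl K z = max (- K) (min K z)" for K z :: real
  have cl_meas[measurable]: "cl K \<in> borel_measurable borel" for K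
    unfolding cl_def by measurable
  have cl_int: "integrable M (\<lambda>x. cl K (f x))" if "f \<in> borel_measurable M" for f K
    by (rule integrable_const_bound[where B = "\<bar>K\<bar>"]) (use that in \<open>auto simp: cl_def\<close>)
  have cl_diff: "\<bar>(\<integral>x. f x \<partial>M) - (\<integral>x. cl K (f x) \<partial>M)\<bar> \<le> (\<integral>x. h K (f x) \<partial>M)"
    if f: "integrable M f" "0 \<le> K" for f K
  proof -
    have "(\<integral>x. f x \<partial>M) - (\<integral>x. cl K (f x) \<partial>M) = (\<integral>x. f x - cl K (f x) \<partial>M)"
      using f cl_int[of f K] by (subst Bochner_Integration.integral_diff) auto
    also have "\<bar>\<dots>\<bar> \<le> (\<integral>x. \<bar>f x - cl K (f x)\<bar> \<partial>M)" by (rule integral_abs_bound)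
    also have "\<dots> = (\<integral>x. h K (f x) \<partial>M)"
      using f(2) by (intro Bochner_Integration.integral_cong) (auto simp: h_def cl_def)
    finally show ?thesis .
  qed
  show "(\<lambda>k. \<integral>x. Z k x \<partial>M) \<longlonglongrightarrow> (\<integral>x. Y x \<partial>M)"
  proof (rule LIMSEQ_I)
    fix e :: real assume e: "0 < e"
    \<comment> \<open>One third for truncating \<open>Z k\<close>, one for truncating
      \<open>Y\<close>, and one for the convergence of the truncated integrals.\<close>
    obtain n where n: "r (real n) < e / 3"
      using order_tendstoD(2)[OF r_lim, of "e / 3"] e by (auto simp: eventually_sequentially)
    define K where "K = real n"
    have K: "0 \<le> K" "r K < e / 3" using n by (auto simp: K_def)
    have "(\<lambda>k. \<integral>x. cl K (Z k x) \<partial>M) \<longlonglongrightarrow> (\<integral>x. cl K (Y x) \<partial>M)"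
    proof (rule integral_dominated_convergence[where w = "\<lambda>x. K"])
      show "AE x in M. (\<lambda>k. cl K (Z k x)) \<longlonglongrightarrow> cl K (Y x)"
        using lim by eventually_elim (auto simp: cl_def intro!: tendsto_intros)
    qed (use K in \<open>auto simp: cl_def\<close>)
    then have "eventually (\<lambda>k. \<bar>(\<integral>x. cl K (Z k x) \<partial>M) - (\<integral>x. cl K (Y x) \<partial>M)\<bar> < e / 3) sequentially"
      using e by (auto dest!: tendstoD[where e = "e / 3"] simp: dist_real_def)
    then obtain k0 where k0: "\<And>k. k0 \<le> k \<Longrightarrow>
        \<bar>(\<integral>x. cl K (Z k x) \<partial>M) - (\<integral>x. cl K (Y x) \<partial>M)\<bar> < e / 3"
      by (auto simp: eventually_sequentially)
    have "norm ((\<integral>x. Z k x \<partial>M) - (\<integral>x. Y x \<partial>M)) < e" if "k0 \<le> k" for k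
    proof -
      have "(\<integral>x. h K (Z k x) \<partial>M) \<le> r K" using tail[OF K(1)] by (simp add: h_def r_def)
      then show ?thesis
        using cl_diff[OF Z K(1), of k] cl_diff[OF Yint K(1)] k0[OF that] tailY[OF K(1)] K(2)
        unfolding real_norm_def by linarith
    qed
    then show "\<exists>no. \<forall>k\<ge>no. norm ((\<integral>x. Z k x \<partial>M) - (\<integral>x. Y x \<partial>M)) < e" by blast
  qed
qed

section \<open>Optional stopping for right-continuous martingales at bounded times\<close>

section \<open>Optional stopping\<close>

context usual_filtered_space
begin

lemma sigma_finite_subalgebra_F: "sigma_finite_subalgebra M (F t)"
  by (rule finite_measure_subalgebra_is_sigma_finite)
     (auto simp: finite_measure_subalgebra_def finite_measure_subalgebra_axioms_def
       subalgebra_F finite_measure_axioms)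

lemma sets_F_subset: "sets (F t) \<subseteq> sets M"
  using subalgebra_F by (auto simp: subalgebra_def)

lemma martingale_integral_indicator:
  assumes Y: "martingale M F Y" and st: "0 \<le> s" "s \<le> t" and D: "D \<in> sets (F (ennreal s))"
  shows "(\<integral>x. indicator D x * Y s x \<partial>M) = (\<integral>x. indicator D x * Y t x \<partial>M)"
proof -
  interpret S: sigma_finite_subalgebra M "F (ennreal s)" by (rule sigma_finite_subalgebra_F)
  have int: "integrable M (Y t)" and AE: "AE x in M. real_cond_exp M (F (ennreal s)) (Y t) x = Y s x"
    using Y st by (auto simp: martingale_def)
  have [measurable]: "D \<in> sets M" using D sets_F_subset by auto
  have [measurable]: "Y s \<in> borel_measurable M"
    using Y st by (auto simp: martingale_def)
  have "(\<integral>x. indicator D x * Y s x \<partial>M)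
      = (\<integral>x. indicator D x * real_cond_exp M (F (ennreal s)) (Y t) x \<partial>M)"
    by (rule integral_cong_AE) (use AE in auto)
  also have "\<dots> = (\<integral>x. indicator D x * Y t x \<partial>M)"
    using S.real_cond_exp_intA[OF int D] by (simp add: set_lebesgue_integral_def)
  finally show ?thesis .
qed

text \<open>A localised Jensen inequality for the convex function
  \<open>max 0 (\<bar>z\<bar> - K)\<close>. On the events \<open>P\<close> and \<open>Q\<close>,
  both known at time \<open>s\<close>, this function of \<open>Y s\<close> is affine, so
  \<open>Y s\<close> can be exchanged for \<open>Y t\<close>. The same affine expression in
  \<open>Y t\<close> is below the excess of \<open>Y t\<close>.\<close>

lemma martingale_tail_indicator:
  assumes Y: "martingale M F Y" and st: "0 \<le> s" "s \<le> t" and D: "D \<in> sets (F (ennreal s))" and K: "0 \<le> K"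
  shows "(\<integral>x. indicator D x * max 0 (\<bar>Y s x\<bar> - K) \<partial>M) \<le> (\<integral>x. indicator D x * max 0 (\<bar>Y t x\<bar> - K) \<partial>M)"
proof -
  have [measurable]: "D \<in> sets M" using D sets_F_subset by auto
  have Ys: "Y s \<in> borel_measurable (F (ennreal s))" and
    int: "integrable M (Y s)" "integrable M (Y t)" using Y st by (auto simp: martingale_def adapted_def)
  note [measurable] = borel_measurable_integrable[OF int(1)] borel_measurable_integrable[OF int(2)]
  have sp: "space (F (ennreal s)) = space M" by (rule space_F)
  define P where "P = D \<inter> {x \<in> space M. K < Y s x}"
  define Q where "Q = D \<inter> {x \<in> space M. Y s x < - K}"
  have P: "P \<in> sets (F (ennreal s))" and Q: "Q \<in> sets (F (ennreal s))"
    using D Ys borel_measurable_iff_greater[of "Y s" "F (ennreal s)"]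
      borel_measurable_iff_less[of "Y s" "F (ennreal s)"] by (auto simp: P_def Q_def sp)
  then have [measurable]: "P \<in> sets M" "Q \<in> sets M" using sets_F_subset by auto
  have ii: "integrable M (\<lambda>x. indicator C x * f x)" if "C \<in> sets M" "integrable M f" for C and f :: "'a \<Rightarrow> real"
    using integrable_mult_indicator[OF that] by simp
  have ic: "integrable M (\<lambda>x. indicator C x * K)" if "C \<in> sets M" for C
    by (rule ii[OF that]) simp
  have PQ: "integrable M (\<lambda>x. indicator C x * Y s x)" "integrable M (\<lambda>x. indicator C x * Y t x)"
      "integrable M (\<lambda>x. indicator C x * K)" if "C \<in> {P, Q}" for C
  proof -
    have "C \<in> sets M" using that by auto
    then show "integrable M (\<lambda>x. indicator C x * Y s x)" "integrable M (\<lambda>x. indicator C x * Y t x)"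
      "integrable M (\<lambda>x. indicator C x * K)"
      using ii int ic by blast+
  qed
  note PQ = PQ[OF insertI1] PQ[OF insertI2[OF singletonI]]
  have "(\<integral>x. indicator D x * max 0 (\<bar>Y s x\<bar> - K) \<partial>M) =
     (\<integral>x. (indicator P x * Y s x - indicator P x * K) - (indicator Q x * Y s x + indicator Q x * K) \<partial>M)"
    using K by (intro Bochner_Integration.integral_cong) (auto simp: P_def Q_def indicator_def)
  also have "\<dots> = (\<integral>x. (indicator P x * Y t x - indicator P x * K) - (indicator Q x * Y t x + indicator Q x * K) \<partial>M)"
    using martingale_integral_indicator[OF Y st P] martingale_integral_indicator[OF Y st Q]
    by (simp only: Bochner_Integration.integral_diff Bochner_Integration.integral_add
      Bochner_Integration.integrable_diff Bochner_Integration.integrable_add PQ)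
  also have "\<dots> \<le> (\<integral>x. indicator D x * max 0 (\<bar>Y t x\<bar> - K) \<partial>M)"
  proof (rule integral_mono)
    have "integrable M (\<lambda>x. max 0 (\<bar>Y t x\<bar> - K))"
      by (rule Bochner_Integration.integrable_bound[OF int(2)]) (use K in auto)
    then show "integrable M (\<lambda>x. indicator D x * max 0 (\<bar>Y t x\<bar> - K))" by (intro ii) auto
  next
    show "integrable M (\<lambda>x. (indicator P x * Y t x - indicator P x * K) - (indicator Q x * Y t x + indicator Q x * K))"
      by (intro Bochner_Integration.integrable_diff Bochner_Integration.integrable_add PQ)
  qed (use K in \<open>auto simp: P_def Q_def indicator_def\<close>)
  finally show ?thesis .
qed

text \<open>The bounded time is approximated from above by times with finitely many values, for
  which the martingale property is summed over the values. All approximations inherit tail bounds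
  from \<open>Y t\<close>, and right-continuity gives convergence, so the integrals converge by
  \<open>integral_tendsto_of_uniform_tails\<close>.\<close>

lemma optional_stopping:
  assumes Y: "martingale M F Y"
    and right: "AE \<omega> in M. \<forall>t\<ge>0. ((\<lambda>s. Y s \<omega>) \<longlongrightarrow> Y t \<omega>) (at_right t)"
    and S: "stopping_time F S" and t: "0 \<le> t"
  shows "integrable M (stopped Y S t)" "(\<integral>\<omega>. stopped Y S t \<omega> \<partial>M) = (\<integral>\<omega>. Y 0 \<omega> \<partial>M)"
proof -
  have Yint: "integrable M (Y s)" if "0 \<le> s" for s using Y that by (auto simp: martingale_def)
  have exp_eq: "(\<integral>\<omega>. Y t \<omega> \<partial>M) = (\<integral>\<omega>. Y 0 \<omega> \<partial>M)"
  proof -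
    have sp: "space M \<in> sets (F (ennreal 0))" using sets.top[of "F (ennreal 0)"] by (simp add: space_F)
    have "(\<integral>\<omega>. indicator (space M) \<omega> * Y s \<omega> \<partial>M) = (\<integral>\<omega>. Y s \<omega> \<partial>M)" for s
      by (rule Bochner_Integration.integral_cong) auto
    then show ?thesis using martingale_integral_indicator[OF Y order_refl t sp] by simp
  qed
  have "integrable M (stopped Y S t) \<and> (\<integral>\<omega>. stopped Y S t \<omega> \<partial>M) = (\<integral>\<omega>. Y t \<omega> \<partial>M)"
  proof (cases "t = 0")
    case True
    then have "stopped Y S t = Y 0" by (auto simp: stopped_def fun_eq_iff)
    then show ?thesis using Yint[of 0] True by simp
  next
    case False
    then have t: "0 < t" using t by simp
    define \<tau> where "\<tau> \<omega> = enn2real (min (ennreal t) (S \<omega>))" for \<omega>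
    have \<tau>: "0 \<le> \<tau> \<omega>" "\<tau> \<omega> \<le> t" for \<omega>
    proof -
      show "0 \<le> \<tau> \<omega>" by (simp add: \<tau>_def)
      have "\<tau> \<omega> \<le> enn2real (ennreal t)" unfolding \<tau>_def by (rule enn2real_mono) auto
      then show "\<tau> \<omega> \<le> t" using t by simp
    qed
    have \<tau>_le: "\<tau> \<omega> \<le> q \<longleftrightarrow> t \<le> q \<or> S \<omega> \<le> ennreal q" if "0 \<le> q" for \<omega> q
    proof -
      have "ennreal (\<tau> \<omega>) = min (ennreal t) (S \<omega>)"
        unfolding \<tau>_def by (rule ennreal_enn2real) (auto simp: min_less_iff_disj)
      then have "\<tau> \<omega> \<le> q \<longleftrightarrow> min (ennreal t) (S \<omega>) \<le> ennreal q"
        using that by (metis ennreal_le_iff)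
      then show ?thesis using that by (simp add: min_le_iff_disj ennreal_le_iff)
    qed
    \<comment> \<open>A grid of [0, t] with \<open>Suc k\<close> steps. The index
      \<open>J k \<omega>\<close> selects the first grid point at or after
      \<open>\<tau> \<omega>\<close>; rounding up keeps the decision to stop adapted and allows
      right-continuity to be used.\<close>
    define q where "q k j = t * real j / real (Suc k)" for k j
    define J where "J k \<omega> = nat \<lceil>\<tau> \<omega> * real (Suc k) / t\<rceil>" for k \<omega>
    define D where "D k j = {\<omega> \<in> space M. J k \<omega> = j}" for k j
    define Z where "Z k \<omega> = Y (q k (J k \<omega>)) \<omega>" for k \<omega>
    have q_nonneg: "0 \<le> q k j" for k j using t by (simp add: q_def)
    have J_le_iff: "J k \<omega> \<le> j \<longleftrightarrow> \<tau> \<omega> \<le> q k j" for k \<omega> j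
    proof -
      have "J k \<omega> \<le> j \<longleftrightarrow> \<tau> \<omega> * real (Suc k) / t \<le> real j"
        by (simp add: J_def nat_le_iff ceiling_le_iff)
      also have "\<dots> \<longleftrightarrow> \<tau> \<omega> \<le> q k j" using t by (simp add: q_def field_simps)
      finally show ?thesis .
    qed
    have J_le: "J k \<omega> \<le> Suc k" for k \<omega> using \<tau>[of \<omega>] t by (simp add: J_le_iff q_def)
    have q_le: "q k j \<le> t" if "j \<le> Suc k" for k j
    proof -
      have "t * real j \<le> t * real (Suc k)" using that t by (intro mult_left_mono) auto
      then show ?thesis unfolding q_def by (subst pos_divide_le_eq) auto
    qed
    have le_sets: "{\<omega> \<in> space M. J k \<omega> \<le> j} \<in> sets (F (ennreal (q k j)))" for k j
    proof -
      have "{\<omega> \<in> space M. S \<omega> \<le> ennreal (q k j)} \<in> sets (F (ennreal (q k j)))"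
        using stopping_timeD[OF S, of "ennreal (q k j)"] by (simp add: pred_def space_F)
      moreover have "space M \<in> sets (F (ennreal (q k j)))"
        using sets.top[of "F (ennreal (q k j))"] by (simp add: space_F)
      ultimately show ?thesis
        \<comment> \<open>At a grid point not below \<open>t\<close> the event is the whole space,
          because \<open>\<tau>\<close> is capped at \<open>t\<close>.\<close>
        by (cases "t \<le> q k j") (simp_all add: J_le_iff \<tau>_le[OF q_nonneg])
    qed
    have D: "D k j \<in> sets (F (ennreal (q k j)))" for k j
    proof (cases j)
      case 0
      then show ?thesis using le_sets[of k 0] by (simp add: D_def)
    next
      case (Suc i)
      have "q k i \<le> q k j" using t Suc by (simp add: q_def divide_right_mono)
      then have "{\<omega> \<in> space M. J k \<omega> \<le> i} \<in> sets (F (ennreal (q k j)))"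
        using le_sets[of k i] sets_F_mono[of "ennreal (q k i)" "ennreal (q k j)"] by (auto simp: ennreal_leI)
      moreover have "D k j = {\<omega> \<in> space M. J k \<omega> \<le> j} - {\<omega> \<in> space M. J k \<omega> \<le> i}"
        using Suc by (auto simp: D_def)
      ultimately show ?thesis using le_sets[of k j] by auto
    qed
    have DM[measurable]: "D k j \<in> sets M" for k j using D sets_F_subset by auto
    \<comment> \<open>A general \<open>f\<close> serves twice: the identity gives the expectation,
      the excess over \<open>K\<close> gives the tails.\<close>
    have Z_sum: "f (Z k \<omega>) = (\<Sum>j\<le>Suc k. indicator (D k j) \<omega> * f (Y (q k j) \<omega>))"
      if "\<omega> \<in> space M" for k \<omega> and f :: "real \<Rightarrow> real"
    proof -
      have "(\<Sum>j\<le>Suc k. indicator (D k j) \<omega> * f (Y (q k j) \<omega>))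
        = (\<Sum>j\<le>Suc k. if j = J k \<omega> then f (Y (q k j) \<omega>) else 0)"
        using that by (intro sum.cong) (auto simp: D_def)
      also have "\<dots> = f (Z k \<omega>)" using J_le[of k \<omega>] by (simp add: sum.delta Z_def)
      finally show ?thesis ..
    qed
    have one_sum: "(\<Sum>j\<le>Suc k. indicator (D k j) \<omega> * c) = (c :: real)" if "\<omega> \<in> space M" for k \<omega> c
    proof -
      have "(\<Sum>j\<le>Suc k. indicator (D k j) \<omega> * c) = (\<Sum>j\<le>Suc k. if j = J k \<omega> then c else 0)"
        using that by (intro sum.cong) (auto simp: D_def)
      also have "\<dots> = c" using J_le[of k \<omega>] by (simp add: sum.delta)
      finally show ?thesis .
    qed
    have ii: "integrable M (\<lambda>x. indicator C x * f x)" if "C \<in> sets M" "integrable M f" for C and f :: "'a \<Rightarrow> real"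
      using integrable_mult_indicator[OF that] by simp
    have Z_sum_id: "Z k \<omega> = (\<Sum>j\<le>Suc k. indicator (D k j) \<omega> * Y (q k j) \<omega>)"
      if "\<omega> \<in> space M" for k \<omega>
      using that by (rule Z_sum)
    have Z_int: "integrable M (Z k)" for k
    proof -
      have "integrable M (\<lambda>\<omega>. \<Sum>j\<le>Suc k. indicator (D k j) \<omega> * Y (q k j) \<omega>)"
        using Yint q_nonneg by (intro Bochner_Integration.integrable_sum ii) auto
      then show ?thesis
        by (rule Bochner_Integration.integrable_cong[THEN iffD1, rotated -1])
           (use Z_sum_id in auto)
    qed
    have Z_exp: "(\<integral>\<omega>. Z k \<omega> \<partial>M) = (\<integral>\<omega>. Y t \<omega> \<partial>M)" for k
    proof -
      have "(\<integral>\<omega>. Z k \<omega> \<partial>M) = (\<integral>\<omega>. (\<Sum>j\<le>Suc k. indicator (D k j) \<omega> * Y (q k j) \<omega>) \<partial>M)"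
        using Z_sum_id by (intro Bochner_Integration.integral_cong) auto
      also have "\<dots> = (\<Sum>j\<le>Suc k. \<integral>\<omega>. indicator (D k j) \<omega> * Y (q k j) \<omega> \<partial>M)"
        using Yint q_nonneg by (intro Bochner_Integration.integral_sum ii) auto
      also have "\<dots> = (\<Sum>j\<le>Suc k. \<integral>\<omega>. indicator (D k j) \<omega> * Y t \<omega> \<partial>M)"
        using q_le by (intro sum.cong refl martingale_integral_indicator[OF Y q_nonneg _ D]) auto
      also have "\<dots> = (\<integral>\<omega>. (\<Sum>j\<le>Suc k. indicator (D k j) \<omega> * Y t \<omega>) \<partial>M)"
        using Yint t by (intro Bochner_Integration.integral_sum[symmetric] ii) auto
      also have "\<dots> = (\<integral>\<omega>. Y t \<omega> \<partial>M)"
        by (intro Bochner_Integration.integral_cong refl one_sum)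
      finally show ?thesis .
    qed
    have tail: "(\<integral>\<omega>. max 0 (\<bar>Z k \<omega>\<bar> - K) \<partial>M) \<le> (\<integral>\<omega>. max 0 (\<bar>Y t \<omega>\<bar> - K) \<partial>M)"
      if K: "0 \<le> K" for k K
    proof -
      have hint: "integrable M (\<lambda>\<omega>. max 0 (\<bar>Y s \<omega>\<bar> - K))" if "0 \<le> s" for s
        by (rule Bochner_Integration.integrable_bound[OF Yint[OF that]])
           (use K borel_measurable_integrable[OF Yint[OF that]] in auto)
      have "(\<integral>\<omega>. max 0 (\<bar>Z k \<omega>\<bar> - K) \<partial>M)
          = (\<integral>\<omega>. (\<Sum>j\<le>Suc k. indicator (D k j) \<omega> * max 0 (\<bar>Y (q k j) \<omega>\<bar> - K)) \<partial>M)"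
        by (intro Bochner_Integration.integral_cong refl Z_sum)
      also have "\<dots> = (\<Sum>j\<le>Suc k. \<integral>\<omega>. indicator (D k j) \<omega> * max 0 (\<bar>Y (q k j) \<omega>\<bar> - K) \<partial>M)"
        using hint q_nonneg by (intro Bochner_Integration.integral_sum ii) auto
      also have "\<dots> \<le> (\<Sum>j\<le>Suc k. \<integral>\<omega>. indicator (D k j) \<omega> * max 0 (\<bar>Y t \<omega>\<bar> - K) \<partial>M)"
        using q_le K by (intro sum_mono martingale_tail_indicator[OF Y q_nonneg _ D]) auto
      also have "\<dots> = (\<integral>\<omega>. (\<Sum>j\<le>Suc k. indicator (D k j) \<omega> * max 0 (\<bar>Y t \<omega>\<bar> - K)) \<partial>M)"
        using hint t by (intro Bochner_Integration.integral_sum[symmetric] ii) auto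
      also have "\<dots> = (\<integral>\<omega>. max 0 (\<bar>Y t \<omega>\<bar> - K) \<partial>M)"
        by (intro Bochner_Integration.integral_cong refl one_sum)
      finally show ?thesis .
    qed
    have lim: "AE \<omega> in M. (\<lambda>k. Z k \<omega>) \<longlonglongrightarrow> stopped Y S t \<omega>"
      using right
    proof eventually_elim
      case (elim \<omega>)
      have "((\<lambda>s. Y s \<omega>) \<longlongrightarrow> Y (\<tau> \<omega>) \<omega>) (at (\<tau> \<omega>) within {\<tau> \<omega>..})"
        using elim \<tau>(1)[of \<omega>] by (simp add: at_within_Ici_at_right)
      then have c: "continuous (at (\<tau> \<omega>) within {\<tau> \<omega>..}) (\<lambda>s. Y s \<omega>)"
        by (simp add: continuous_within)
      have ge: "\<tau> \<omega> \<le> q k (J k \<omega>)" for k using J_le_iff by blast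
      have le: "q k (J k \<omega>) \<le> \<tau> \<omega> + t * inverse (real (Suc k))" for k
      proof -
        have "real (J k \<omega>) \<le> \<tau> \<omega> * real (Suc k) / t + 1"
        proof -
          have "0 \<le> \<tau> \<omega> * real (Suc k) / t" using \<tau>(1)[of \<omega>] t by simp
          then show ?thesis unfolding J_def by linarith
        qed
        then have "t * real (J k \<omega>) \<le> t * (\<tau> \<omega> * real (Suc k) / t + 1)"
          using t by (intro mult_left_mono) auto
        also have "\<dots> = (\<tau> \<omega> + t * inverse (real (Suc k))) * real (Suc k)"
          using t by (simp add: field_simps)
        finally show ?thesis
          unfolding q_def by (subst pos_divide_le_eq) auto
      qed
      have "(\<lambda>k. \<tau> \<omega> + t * inverse (real (Suc k))) \<longlonglongrightarrow> \<tau> \<omega> + t * 0"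
        by (intro tendsto_intros LIMSEQ_inverse_real_of_nat)
      then have "(\<lambda>k. \<tau> \<omega> + t * inverse (real (Suc k))) \<longlonglongrightarrow> \<tau> \<omega>" by simp
      then have "(\<lambda>k. q k (J k \<omega>)) \<longlonglongrightarrow> \<tau> \<omega>"
        by (rule tendsto_sandwich[OF _ _ tendsto_const, rotated -1]) (use ge le in auto)
      then have "(\<lambda>k. Y (q k (J k \<omega>)) \<omega>) \<longlonglongrightarrow> Y (\<tau> \<omega>) \<omega>"
        by (rule continuous_within_tendsto_compose[OF c, rotated]) (use ge in auto)
      then show ?case by (simp add: Z_def stopped_def \<tau>_def)
    qed
    have Z_meas: "Z k \<in> borel_measurable M" for k using Z_int by auto
    have meas: "stopped Y S t \<in> borel_measurable M"
    proof (rule measurable_AE_cong)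
      show "(\<lambda>\<omega>. lim (\<lambda>k. Z k \<omega>)) \<in> borel_measurable M"
        using Z_meas by (rule borel_measurable_lim_metric)
      show "AE \<omega> in M. stopped Y S t \<omega> = lim (\<lambda>k. Z k \<omega>)"
        using lim by eventually_elim (simp add: limI)
    qed simp
    note * = integral_tendsto_of_uniform_tails[OF Z_int Yint[of t] meas tail lim]
    have "(\<integral>\<omega>. stopped Y S t \<omega> \<partial>M) = (\<integral>\<omega>. Y t \<omega> \<partial>M)"
      using *(2) t unfolding Z_exp by (simp add: LIMSEQ_const_iff)
    then show ?thesis using *(1) t by simp
  qed
  then show "integrable M (stopped Y S t)" "(\<integral>\<omega>. stopped Y S t \<omega> \<partial>M) = (\<integral>\<omega>. Y 0 \<omega> \<partial>M)"
    using exp_eq by auto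
qed

end

section \<open>Debuts as stopping times, and right-continuity of stopped paths\<close>

section \<open>The first passage above a level\<close>

context usual_filtered_space
begin

text \<open>The debut is at most \<open>t\<close> iff for every rational \<open>r\<close> slightly
  above \<open>t\<close> the condition holds at some rational time before \<open>r\<close>.
  Restricting to \<open>r\<close> below \<open>s\<close> makes this an event of \<open>F s\<close>;
  since \<open>s > t\<close> is arbitrary, right-continuity of the filtration places it in
  \<open>F t\<close>.\<close>

lemma stopping_time_debut:
  assumes P: "\<And>q. 0 \<le> q \<Longrightarrow> Measurable.pred (F (ennreal q)) (P q)"
  shows "stopping_time F (\<lambda>\<omega>. debut (\<lambda>q. P q \<omega>))"
proof
  fix t :: ennreal
  show "Measurable.pred (F t) (\<lambda>\<omega>. debut (\<lambda>q. P q \<omega>) \<le> t)"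
  proof (cases "t < \<infinity>")
    case False
    then show ?thesis by (simp add: top.not_eq_extremum[symmetric])
  next
    case True
    have "{\<omega> \<in> space M. debut (\<lambda>q. P q \<omega>) \<le> t} \<in> sets (F s)" if "t < s" for s
    proof -
      let ?R = "{r \<in> \<rat>. t < ennreal r \<and> ennreal r < s}"
      let ?Q = "\<lambda>r. {q \<in> \<rat>. 0 \<le> q \<and> ennreal q < ennreal r}"
      have eq: "debut (\<lambda>q. P q \<omega>) \<le> t \<longleftrightarrow> (\<forall>r\<in>?R. \<exists>q\<in>?Q r. P q \<omega>)" for \<omega>
      proof -
        have "(\<exists>q\<in>?Q r. P q \<omega>) \<longleftrightarrow> debut (\<lambda>q. P q \<omega>) < ennreal r" for r
          by (auto simp: debut_less_iff)
        moreover have "debut (\<lambda>q. P q \<omega>) \<le> t \<longleftrightarrow> (\<forall>r\<in>?R. debut (\<lambda>q. P q \<omega>) < ennreal r)"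
        proof (intro iffI ballI)
          assume *: "\<forall>r\<in>?R. debut (\<lambda>q. P q \<omega>) < ennreal r"
          show "debut (\<lambda>q. P q \<omega>) \<le> t"
          proof (rule ccontr)
            assume "\<not> ?thesis"
            then have "t < min s (debut (\<lambda>q. P q \<omega>))" using \<open>t < s\<close> by simp
            then obtain r where r: "t < ennreal (real_of_rat r)"
              "ennreal (real_of_rat r) < min s (debut (\<lambda>q. P q \<omega>))"
              using ennreal_rat_dense by blast
            then have "real_of_rat r \<in> ?R" by auto
            then have "debut (\<lambda>q. P q \<omega>) < ennreal (real_of_rat r)" using * by blast
            then show False using r(2) by (meson min_less_iff_conj order.asym)
          qed
        qed auto
        ultimately show ?thesis by simp
      qed
      have "Measurable.pred (F s) (\<lambda>\<omega>. \<forall>r\<in>?R. \<exists>q\<in>?Q r. P q \<omega>)"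
      proof (intro measurable_pred_countable)
        fix r q assume "r \<in> ?R" and q: "q \<in> ?Q r"
        then have "ennreal q \<le> s" by auto
        then show "Measurable.pred (F s) (P q)"
          using P[of q] q sets_F_mono[of "ennreal q" s] by (auto simp: pred_def space_F)
      qed (rule countable_subset[OF _ countable_rat], auto)+
      then show ?thesis unfolding eq[symmetric] by (simp add: pred_def space_F)
    qed
    then show ?thesis using right_continuous_F[OF True] by (simp add: pred_def space_F)
  qed
qed

end

text \<open>From \<open>\<tau>\<close> on the stopped path is constant; before \<open>\<tau>\<close>
  it agrees with \<open>f\<close> on a right neighbourhood.\<close>

lemma right_continuous_stopped:
  fixes f :: "real \<Rightarrow> real"
  assumes f: "\<And>t. 0 \<le> t \<Longrightarrow> (f \<longlongrightarrow> f t) (at_right t)" and t: "0 \<le> t"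
  shows "((\<lambda>s. f (enn2real (min (ennreal s) \<tau>))) \<longlongrightarrow> f (enn2real (min (ennreal t) \<tau>))) (at_right t)"
proof (cases "\<tau> \<le> ennreal t")
  case True
  have "eventually (\<lambda>s. f (enn2real (min (ennreal t) \<tau>)) = f (enn2real (min (ennreal s) \<tau>))) (at_right t)"
    unfolding eventually_at_right_field
  proof (intro exI conjI allI impI)
    show "t < t + 1" by simp
    fix s assume "t < s"
    then have "\<tau> \<le> ennreal s" using True by (meson ennreal_leI less_imp_le order_trans)
    then show "f (enn2real (min (ennreal t) \<tau>)) = f (enn2real (min (ennreal s) \<tau>))"
      using True by (simp add: min_absorb2)
  qed
  then show ?thesis by (rule Lim_transform_eventually[OF tendsto_const])
next
  case False
  obtain b where b: "t < b" "ennreal b \<le> \<tau>"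
  proof (cases \<tau>)
    case (real r)
    then show ?thesis using that[of r] False t by (auto simp: ennreal_le_iff not_le)
  next
    case top
    then show ?thesis using that[of "t + 1"] by auto
  qed
  have "eventually (\<lambda>s. f s = f (enn2real (min (ennreal s) \<tau>))) (at_right t)"
    unfolding eventually_at_right_field
  proof (intro exI conjI allI impI)
    show "t < b" by fact
    fix s assume s: "t < s" "s < b"
    then have "ennreal s \<le> \<tau>" using b by (meson ennreal_leI less_imp_le order_trans)
    then show "f s = f (enn2real (min (ennreal s) \<tau>))" using s t by (simp add: min_absorb1)
  qed
  moreover have "enn2real (min (ennreal t) \<tau>) = t" using False t by (simp add: min_absorb1)
  ultimately show ?thesis using f[OF t] by (auto intro: Lim_transform_eventually)
qed

section \<open>Hitting probabilities from optional stopping\<close>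

locale sigma_class = usual_filtered_space M F
  for M :: "'a measure" and F :: "ennreal \<Rightarrow> 'a measure" +
  fixes X N A :: "real \<Rightarrow> 'a \<Rightarrow> real"
  assumes paths: "AE \<omega> in M. reflected_path (\<lambda>t. X t \<omega>) (\<lambda>t. A t \<omega>)"
    and decomp: "AE \<omega> in M. \<forall>t\<ge>0. N t \<omega> = X t \<omega> - A t \<omega>"
    and N_right: "AE \<omega> in M. \<forall>t\<ge>0. ((\<lambda>s. N s \<omega>) \<longlongrightarrow> N t \<omega>) (at_right t)"
    and N_local: "local_martingale M F N"
    and X_adapted: "adapted F X" and A_adapted: "adapted F A"
begin

definition \<sigma> :: "real \<Rightarrow> 'a \<Rightarrow> ennreal" where
  "\<sigma> v \<omega> = debut (\<lambda>q. v \<le> A q \<omega>)"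

definition T :: "real \<Rightarrow> real \<Rightarrow> 'a \<Rightarrow> ennreal" where
  "T n c \<omega> = debut (\<lambda>q. n \<le> A q \<omega> \<and> c < X q \<omega>)"

text \<open>Capping by \<open>\<sigma> v\<close> makes the time almost surely finite and keeps
  \<open>A\<close> bounded by \<open>v\<close> up to it when \<open>v\<close> is positive.\<close>

definition R :: "real \<Rightarrow> real \<Rightarrow> real \<Rightarrow> 'a \<Rightarrow> ennreal" where
  "R n c v \<omega> = min (T n c \<omega>) (\<sigma> v \<omega>)"

lemma stopping_time_\<sigma>: "stopping_time F (\<sigma> v)"
proof -
  have "Measurable.pred (F (ennreal q)) (\<lambda>\<omega>. v \<le> A q \<omega>)" if "0 \<le> q" for q
  proof -
    have [measurable]: "A q \<in> borel_measurable (F (ennreal q))"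
      using A_adapted that by (simp add: adapted_def)
    show ?thesis by measurable
  qed
  from stopping_time_debut[OF this] show ?thesis by (simp add: \<sigma>_def[abs_def])
qed

lemma stopping_time_T: "stopping_time F (T n c)"
proof -
  have "Measurable.pred (F (ennreal q)) (\<lambda>\<omega>. n \<le> A q \<omega> \<and> c < X q \<omega>)" if "0 \<le> q" for q
  proof -
    have [measurable]: "A q \<in> borel_measurable (F (ennreal q))" "X q \<in> borel_measurable (F (ennreal q))"
      using A_adapted X_adapted that by (simp_all add: adapted_def)
    show ?thesis by measurable
  qed
  from stopping_time_debut[OF this] show ?thesis by (simp add: T_def[abs_def])
qed

lemma stopping_time_R: "stopping_time F (R n c v)"
  unfolding R_def[abs_def] by (intro stopping_time_min stopping_time_T stopping_time_\<sigma>)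

lemma T_measurable[measurable]: "T n c \<in> borel_measurable M"
  by (rule measurable_stopping_time[OF stopping_time_T]) (use sets_F_subset space_F in auto)

lemma \<sigma>_measurable[measurable]: "\<sigma> v \<in> borel_measurable M"
  by (rule measurable_stopping_time[OF stopping_time_\<sigma>]) (use sets_F_subset space_F in auto)

text \<open>Optional stopping at \<open>R n c v\<close> and at \<open>\<sigma> n\<close>: between these two times \<open>X\<close> stays below \<open>c\<close>
  and \<open>A\<close> grows by at most \<open>v - n\<close>, so that the localisation can be removed by bounded convergence.\<close>

lemma
  assumes n: "0 < n" and c: "0 < c" and v: "n \<le> v"
  shows A_R_integrable: "integrable M (\<lambda>\<omega>. A (enn2real (R n c v \<omega>)) \<omega> - n)"
    and hit_prob_eq: "c * prob {\<omega> \<in> space M. T n c \<omega> < \<sigma> v \<omega>} = (\<integral>\<omega>. A (enn2real (R n c v \<omega>)) \<omega> - n \<partial>M)"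
proof -
  from N_local obtain \<rho> where \<rho>: "\<And>m. stopping_time F (\<rho> m)"
    and \<rho>_lim: "AE \<omega> in M. incseq (\<lambda>m. \<rho> m \<omega>) \<and> (\<lambda>m. \<rho> m \<omega>) \<longlonglongrightarrow> \<infinity>"
    and mart: "\<And>m :: nat. martingale M F (\<lambda>t \<omega>. stopped N (\<rho> m) t \<omega> - N 0 \<omega>)"
    by (auto simp: local_martingale_def locally_in_def)
  define Y where "Y m t \<omega> = stopped N (\<rho> m) t \<omega> - N 0 \<omega>" for m t \<omega>
  \<comment> \<open>Optional stopping is available at bounded times only; \<open>p m\<close> merges
    the horizon \<open>m\<close> with the localising time \<open>\<rho> m\<close> into one finite
    time that tends to infinity.\<close>
  define p where "p m \<omega> = enn2real (min (ennreal (real m)) (\<rho> m \<omega>))" for m \<omega>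
  have p_nonneg: "0 \<le> p m \<omega>" for m \<omega> by (simp add: p_def)
  have p_eq: "ennreal (p m \<omega>) = min (ennreal (real m)) (\<rho> m \<omega>)" for m \<omega>
    unfolding p_def by (rule ennreal_enn2real) (auto simp: min_less_iff_disj)
  have Y_stopped: "stopped (Y m) S (real m) \<omega> = N (enn2real (min (ennreal (p m \<omega>)) (S \<omega>))) \<omega> - N 0 \<omega>" for m S \<omega>
  proof -
    have "ennreal (enn2real (min (ennreal (real m)) (S \<omega>))) = min (ennreal (real m)) (S \<omega>)"
      by (rule ennreal_enn2real) (auto simp: min_less_iff_disj)
    then show ?thesis
      by (simp add: stopped_def Y_def p_eq min.assoc min.commute min.left_commute)
  qed
  have Y_mart: "martingale M F (Y m)" for m using mart[of m] by (simp add: Y_def[abs_def])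
  have Y_right: "AE \<omega> in M. \<forall>t\<ge>0. ((\<lambda>s. Y m s \<omega>) \<longlongrightarrow> Y m t \<omega>) (at_right t)" for m
    using N_right
  proof eventually_elim
    case (elim \<omega>)
    then show ?case
      unfolding Y_def stopped_def
      by (intro allI impI tendsto_diff tendsto_const right_continuous_stopped[where f = "\<lambda>s. N s \<omega>"]) auto
  qed
  have Y0: "(\<integral>\<omega>. Y m 0 \<omega> \<partial>M) = 0" for m
    by (simp add: Y_def stopped_def)
  define D where "D m \<omega> = stopped (Y m) (R n c v) (real m) \<omega> - stopped (Y m) (\<sigma> n) (real m) \<omega>" for m \<omega>
  have D_int: "integrable M (D m)" and D_exp: "(\<integral>\<omega>. D m \<omega> \<partial>M) = 0" for m
    unfolding D_def
    using optional_stopping[OF Y_mart Y_right stopping_time_R, of "real m" m n c v]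
      optional_stopping[OF Y_mart Y_right stopping_time_\<sigma>, of "real m" m n] Y0[of m]
    by simp_all
  define W where "W \<omega> = c * indicator {\<omega> \<in> space M. T n c \<omega> < \<sigma> v \<omega>} \<omega> - (A (enn2real (R n c v \<omega>)) \<omega> - n)" for \<omega>
  have D_eq: "D m \<omega> = N (enn2real (min (ennreal (p m \<omega>)) (R n c v \<omega>))) \<omega> -
      N (enn2real (min (ennreal (p m \<omega>)) (\<sigma> n \<omega>))) \<omega>" for m \<omega>
    by (simp add: D_def Y_stopped)
  have D_bound: "AE \<omega> in M. norm (D m \<omega>) \<le> c + (v - n)" for m
    using paths decomp
  proof eventually_elim
    case (elim \<omega>)
    interpret reflected_path "\<lambda>t. X t \<omega>" "\<lambda>t. A t \<omega>" by fact
    show ?case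
      using increment_bound[OF n c v p_nonneg, of "\<lambda>t. N t \<omega>" m \<omega>] elim
      by (simp add: D_eq R_def T_def \<sigma>_def)
  qed
  have D_lim: "AE \<omega> in M. (\<lambda>m. D m \<omega>) \<longlonglongrightarrow> W \<omega>"
    using paths decomp \<rho>_lim AE_space
  proof eventually_elim
    case (elim \<omega>)
    interpret reflected_path "\<lambda>t. X t \<omega>" "\<lambda>t. A t \<omega>" by fact
    have fin: "R n c v \<omega> < \<infinity>"
      using stop_level_bounds(4)[OF n c v] by (simp add: R_def T_def \<sigma>_def)
    have "(\<lambda>m. ennreal (real m)) \<longlonglongrightarrow> \<infinity>"
      using of_nat_tendsto_top_ennreal by (simp add: ennreal_of_nat_eq_real_of_nat)
    then have "eventually (\<lambda>m. R n c v \<omega> < ennreal (real m)) sequentially"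
      using fin by (rule order_tendstoD)
    moreover have "eventually (\<lambda>m. R n c v \<omega> < \<rho> m \<omega>) sequentially"
      using elim(3) fin by (auto intro: order_tendstoD)
    ultimately have "eventually (\<lambda>m. W \<omega> = D m \<omega>) sequentially"
    proof eventually_elim
      case (elim m)
      then have "R n c v \<omega> \<le> ennreal (p m \<omega>)" by (simp add: p_eq less_imp_le)
      then show ?case
        using increment_eq[OF n c v p_nonneg, of "\<lambda>t. N t \<omega>" m \<omega>] \<open>\<forall>t\<ge>0. N t \<omega> = X t \<omega> - A t \<omega>\<close> \<open>\<omega> \<in> space M\<close>
        by (simp add: W_def D_eq R_def T_def \<sigma>_def)
    qed
    then show ?case by (rule Lim_transform_eventually[OF tendsto_const])
  qed
  have W_meas: "W \<in> borel_measurable M"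
  proof (rule measurable_AE_cong)
    show "(\<lambda>\<omega>. lim (\<lambda>k. D k \<omega>)) \<in> borel_measurable M"
      using D_int by (intro borel_measurable_lim_metric) auto
    show "AE \<omega> in M. W \<omega> = lim (\<lambda>k. D k \<omega>)"
      using D_lim by eventually_elim (simp add: limI)
  qed simp
  have dc: "integrable M W" "(\<lambda>m. \<integral>\<omega>. D m \<omega> \<partial>M) \<longlonglongrightarrow> (\<integral>\<omega>. W \<omega> \<partial>M)"
    using integrable_dominated_convergence[OF W_meas _ _ D_lim D_bound]
      integral_dominated_convergence[OF W_meas _ _ D_lim D_bound] D_int by auto
  have ind: "integrable M (\<lambda>\<omega>. c * indicator {\<omega> \<in> space M. T n c \<omega> < \<sigma> v \<omega>} \<omega>)"
    by (intro integrable_mult_right integrable_real_indicator) (auto simp: emeasure_eq_measure)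
  \<comment> \<open>Measurability and integrability of \<open>A\<close> at the random time are read
    off from \<open>W\<close>, which is an almost sure limit of the integrable \<open>D m\<close>;
    joint measurability of \<open>A\<close> is never invoked.\<close>
  have A_eq: "(\<lambda>\<omega>. A (enn2real (R n c v \<omega>)) \<omega> - n) =
     (\<lambda>\<omega>. c * indicator {\<omega> \<in> space M. T n c \<omega> < \<sigma> v \<omega>} \<omega> - W \<omega>)"
    by (simp add: W_def fun_eq_iff)
  show "integrable M (\<lambda>\<omega>. A (enn2real (R n c v \<omega>)) \<omega> - n)"
    unfolding A_eq using ind dc(1) by (rule Bochner_Integration.integrable_diff)
  have "(\<integral>\<omega>. W \<omega> \<partial>M) = 0" using dc(2) by (simp add: D_exp LIMSEQ_const_iff)
  then show "c * prob {\<omega> \<in> space M. T n c \<omega> < \<sigma> v \<omega>} = (\<integral>\<omega>. A (enn2real (R n c v \<omega>)) \<omega> - n \<partial>M)"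
    unfolding A_eq using ind dc(1) by (subst Bochner_Integration.integral_diff) auto
qed

text \<open>Subtracting \<open>hit_prob_eq\<close> for the levels \<open>u\<close> and
  \<open>v\<close> and applying \<open>stop_level_diff\<close> gives the Lipschitz bound. For
  finiteness, \<open>A\<close> has grown by \<open>v - n\<close> whenever \<open>\<sigma> v\<close>
  comes no later than \<open>T\<close>, so \<open>hit_prob_eq\<close> bounds \<open>v - n\<close>
  times the probability of this event by \<open>c\<close>; then \<open>v\<close> tends to
  infinity.\<close>

lemma
  assumes n: "0 < n" and c: "0 < c"
  shows AE_T_finite: "AE \<omega> in M. T n c \<omega> < \<infinity>"
    and hit_prob_diff: "\<And>u v. n \<le> u \<Longrightarrow> u \<le> v \<Longrightarrow>
      prob {\<omega> \<in> space M. T n c \<omega> < \<sigma> v \<omega>} - prob {\<omega> \<in> space M. T n c \<omega> < \<sigma> u \<omega>} \<le> (v - u) / c"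
proof -
  define P where "P v = prob {\<omega> \<in> space M. T n c \<omega> < \<sigma> v \<omega>}" for v
  note eq = hit_prob_eq[OF n c, folded P_def] and int = A_R_integrable[OF n c]
  show "prob {\<omega> \<in> space M. T n c \<omega> < \<sigma> v \<omega>} - prob {\<omega> \<in> space M. T n c \<omega> < \<sigma> u \<omega>} \<le> (v - u) / c"
    if u: "n \<le> u" "u \<le> v" for u v
  proof -
    have v: "n \<le> v" using u by simp
    have "c * (P v - P u) = (\<integral>\<omega>. (A (enn2real (R n c v \<omega>)) \<omega> - n) - (A (enn2real (R n c u \<omega>)) \<omega> - n) \<partial>M)"
      using eq[OF v] eq[OF u(1)] int[OF v] int[OF u(1)]
      by (subst Bochner_Integration.integral_diff) (auto simp: right_diff_distrib)
    also have "\<dots> \<le> (\<integral>\<omega>. v - u \<partial>M)"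
    proof (rule integral_mono_AE)
      show "AE \<omega> in M. (A (enn2real (R n c v \<omega>)) \<omega> - n) - (A (enn2real (R n c u \<omega>)) \<omega> - n) \<le> v - u"
        using paths
      proof eventually_elim
        case (elim \<omega>)
        interpret reflected_path "\<lambda>t. X t \<omega>" "\<lambda>t. A t \<omega>" by fact
        show ?case using stop_level_diff[OF n c u] by (simp add: R_def T_def \<sigma>_def)
      qed
    qed (intro Bochner_Integration.integrable_diff int v u(1) integrable_const)+
    also have "\<dots> = v - u" by (simp add: prob_space)
    finally show ?thesis using c by (simp add: P_def field_simps)
  qed
  define Q where "Q = prob {\<omega> \<in> space M. T n c \<omega> < \<infinity>}"
  have bound: "real k * (1 - Q) \<le> c" for k :: nat
  proof -
    define v where "v = n + real k"
    have v: "n \<le> v" by (simp add: v_def)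
    let ?E = "{\<omega> \<in> space M. T n c \<omega> < \<sigma> v \<omega>}"
    have "P v \<le> Q" unfolding P_def Q_def
      by (intro finite_measure_mono) (auto intro: less_le_trans)
    have "(v - n) * (1 - P v) = (\<integral>\<omega>. (v - n) * indicator (space M - ?E) \<omega> \<partial>M)"
      by (simp add: P_def prob_compl)
    also have "\<dots> \<le> (\<integral>\<omega>. A (enn2real (R n c v \<omega>)) \<omega> - n \<partial>M)"
    proof (rule integral_mono_AE)
      show "AE \<omega> in M. (v - n) * indicator (space M - ?E) \<omega> \<le> A (enn2real (R n c v \<omega>)) \<omega> - n"
        using paths
      proof eventually_elim
        case (elim \<omega>)
        interpret reflected_path "\<lambda>t. X t \<omega>" "\<lambda>t. A t \<omega>" by fact
        show ?case
          using stop_level_bounds(1,3)[OF n c v] by (auto simp: R_def T_def \<sigma>_def indicator_def)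
      qed
      show "integrable M (\<lambda>\<omega>. (v - n) * indicator (space M - ?E) \<omega>)"
        by (intro integrable_mult_right integrable_real_indicator) (auto simp: emeasure_eq_measure)
    qed (rule int[OF v])
    also have "\<dots> = c * P v" by (rule eq[OF v, symmetric])
    also have "\<dots> \<le> c" using c by (simp add: P_def)
    finally have "real k * (1 - P v) \<le> c" by (simp add: v_def)
    moreover have "real k * (1 - Q) \<le> real k * (1 - P v)"
      using \<open>P v \<le> Q\<close> by (intro mult_left_mono) auto
    ultimately show ?thesis by simp
  qed
  have "Q = 1"
  proof (rule ccontr)
    assume "Q \<noteq> 1"
    then have "0 < 1 - Q" unfolding Q_def by (simp add: less_le)
    then obtain k :: nat where "c < real k * (1 - Q)" using reals_Archimedean3 by blast
    with bound[of k] show False by simp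
  qed
  then show "AE \<omega> in M. T n c \<omega> < \<infinity>"
    unfolding Q_def by (subst (asm) prob_Collect_eq_1) auto
qed

section \<open>The law of \<open>A\<close> at the hitting time\<close>

definition V :: "real \<Rightarrow> real \<Rightarrow> 'a \<Rightarrow> real" where
  "V n c \<omega> = A (enn2real (T n c \<omega>)) \<omega>"

lemma AE_V:
  assumes n: "0 < n" and c: "0 < c"
  shows "AE \<omega> in M. n \<le> V n c \<omega> \<and> X (enn2real (T n c \<omega>)) \<omega> = c \<and>
    (\<forall>v>0. V n c \<omega> < v \<longleftrightarrow> T n c \<omega> < \<sigma> v \<omega>)"
  using paths AE_T_finite[OF n c]
proof eventually_elim
  case (elim \<omega>)
  interpret reflected_path "\<lambda>t. X t \<omega>" "\<lambda>t. A t \<omega>" by fact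
  from elim(2) obtain h where h: "hit n c = ennreal h" "0 \<le> h"
    unfolding T_def by (cases "hit n c") auto
  show ?case
    using hit_values[OF n c h] hit_less_level_iff[OF n c] elim(2) h
    unfolding V_def T_def \<sigma>_def by auto
qed

text \<open>For positive \<open>v\<close> the sublevel event agrees almost surely with
  \<open>T n c < \<sigma> v\<close>, and for other \<open>v\<close> with the empty set; completeness
  does the rest.\<close>

lemma V_measurable:
  assumes n: "0 < n" and c: "0 < c"
  shows "V n c \<in> borel_measurable M"
  unfolding borel_measurable_iff_less
proof
  fix v
  show "{\<omega> \<in> space M. V n c \<omega> < v} \<in> sets M"
  proof (cases "0 < v")
    case True
    have "AE \<omega> in M. \<omega> \<in> {\<omega> \<in> space M. T n c \<omega> < \<sigma> v \<omega>} \<longleftrightarrow> \<omega> \<in> {\<omega> \<in> space M. V n c \<omega> < v}"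
      using AE_V[OF n c] by eventually_elim (use True in auto)
    then show ?thesis by (rule in_sets_AE) auto
  next
    case False
    have "AE \<omega> in M. \<omega> \<in> {} \<longleftrightarrow> \<omega> \<in> {\<omega> \<in> space M. V n c \<omega> < v}"
      using AE_V[OF n c] by eventually_elim (use False n in auto)
    then show ?thesis by (rule in_sets_AE) auto
  qed
qed

text \<open>By \<open>AE_V\<close> the distribution function of \<open>V n c\<close> is the
  probability of \<open>T n c < \<sigma> v\<close>, which \<open>hit_prob_diff\<close> shows to be
  Lipschitz with constant \<open>1 / c\<close> on [n, \<infinity>).
  \<open>emeasure_le_lborel\<close> extends the bound from intervals to Borel sets.\<close>

lemma V_law_le:
  assumes n: "0 < n" and c: "0 < c" and B: "B \<in> sets borel"
  shows "emeasure M {\<omega> \<in> space M. V n c \<omega> \<in> B} \<le> ennreal (1 / c) * emeasure lborel (B \<inter> {n..})"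
proof -
  note [measurable] = V_measurable[OF n c]
  have B': "B \<inter> {n..} \<in> sets borel" using B by simp
  have "emeasure M {\<omega> \<in> space M. V n c \<omega> \<in> B} = emeasure M {\<omega> \<in> space M. V n c \<omega> \<in> B \<inter> {n..}}"
  proof (rule emeasure_eq_AE)
    show "AE \<omega> in M. \<omega> \<in> {\<omega> \<in> space M. V n c \<omega> \<in> B} \<longleftrightarrow> \<omega> \<in> {\<omega> \<in> space M. V n c \<omega> \<in> B \<inter> {n..}}"
      using AE_V[OF n c] by eventually_elim auto
  qed (use B in measurable)
  also have "\<dots> = emeasure (distr M borel (V n c)) (B \<inter> {n..})"
    using B' by (subst emeasure_distr) (auto intro!: arg_cong[where f = "emeasure M"])
  also have "\<dots> \<le> ennreal (1 / c) * emeasure lborel (B \<inter> {n..})"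
  proof (rule emeasure_le_lborel[OF _ _ _ B'])
    fix u v :: real assume uv: "u < v"
    \<comment> \<open>Clipping at \<open>n\<close> brings the endpoints into the range of
      \<open>hit_prob_diff\<close> and loses nothing, because \<open>V n c\<close> is almost surely
      at least \<open>n\<close>.\<close>
    define u' v' where "u' = max u n" and "v' = max v n"
    let ?E = "\<lambda>v. {\<omega> \<in> space M. T n c \<omega> < \<sigma> v \<omega>}"
    have "emeasure (distr M borel (V n c)) {u..<v} = emeasure M {\<omega> \<in> space M. u \<le> V n c \<omega> \<and> V n c \<omega> < v}"
      by (subst emeasure_distr) (auto intro!: arg_cong[where f = "emeasure M"])
    also have "\<dots> = emeasure M (?E v' - ?E u')"
    proof (rule emeasure_eq_AE)
      show "AE \<omega> in M. \<omega> \<in> {\<omega> \<in> space M. u \<le> V n c \<omega> \<and> V n c \<omega> < v} \<longleftrightarrow> \<omega> \<in> ?E v' - ?E u'"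
        using AE_V[OF n c]
      proof eventually_elim
        case (elim \<omega>)
        then have "V n c \<omega> < v' \<longleftrightarrow> T n c \<omega> < \<sigma> v' \<omega>" "V n c \<omega> < u' \<longleftrightarrow> T n c \<omega> < \<sigma> u' \<omega>" "n \<le> V n c \<omega>"
          using n by (auto simp: u'_def v'_def)
        then show ?case by (auto simp: u'_def v'_def)
      qed
    qed auto
    also have "\<dots> = ennreal (measure M (?E v' - ?E u'))" by (rule emeasure_eq_measure)
    also have "measure M (?E v' - ?E u') = prob (?E v') - prob (?E u')"
    proof (rule finite_measure_Diff)
      have "\<sigma> u' \<omega> \<le> \<sigma> v' \<omega>" for \<omega>
        unfolding \<sigma>_def using uv by (intro debut_antimono) (auto simp: u'_def v'_def)
      then show "?E u' \<subseteq> ?E v'" by (auto intro: less_le_trans)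
    qed auto
    also have "\<dots> \<le> (v' - u') / c"
      using uv by (intro hit_prob_diff[OF n c]) (auto simp: u'_def v'_def)
    also have "\<dots> \<le> 1 / c * (v - u)"
      using uv c by (auto simp: u'_def v'_def max_def field_simps)
    finally show "emeasure (distr M borel (V n c)) {u..<v} \<le> ennreal (1 / c * (v - u))"
      by (simp add: ennreal_leI)
  qed (use c in auto)
  finally show ?thesis .
qed

text \<open>Finite measure of \<open>B\<close> makes the measure of its part beyond \<open>n\<close>
  tend to 0. The event that \<open>V n c\<close> lies in \<open>B\<close> for all the levels
  \<open>n\<close> therefore has probability 0, and off it some hitting time is the required
  \<open>t\<close>.\<close>

lemma AE_exceeds:
  fixes B :: "real set"
  assumes c: "0 < c" and B: "B \<in> sets borel" and fin: "emeasure lborel B < \<infinity>"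
  shows "AE \<omega> in M. \<exists>t\<ge>0. X t \<omega> = c \<and> 0 \<le> A t \<omega> \<and> A t \<omega> \<notin> B"
proof -
  have pos: "0 < real (Suc n)" for n by simp
  let ?E = "\<Inter>n. {\<omega> \<in> space M. V (real (Suc n)) c \<omega> \<in> B}"
  have E: "{\<omega> \<in> space M. V (real (Suc n)) c \<omega> \<in> B} \<in> sets M" for n
    using V_measurable[OF pos c, of n] B by measurable
  have "(\<lambda>n. emeasure lborel (B \<inter> {real (Suc n)..})) \<longlonglongrightarrow> emeasure lborel (\<Inter>n. B \<inter> {real (Suc n)..})"
  proof (rule Lim_emeasure_decseq)
    show "emeasure lborel (B \<inter> {real (Suc n)..}) \<noteq> \<infinity>" for n
      using emeasure_mono[of "B \<inter> {real (Suc n)..}" B lborel] B fin by (auto simp: top_unique)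
  qed (use B in \<open>auto simp: decseq_def\<close>)
  also have "(\<Inter>n. B \<inter> {real (Suc n)..}) = {}"
  proof -
    have "\<exists>n. \<not> real (Suc n) \<le> x" for x
    proof -
      obtain n where "x < real n" using reals_Archimedean2 by blast
      then have "\<not> real (Suc n) \<le> x" by simp
      then show ?thesis by blast
    qed
    then show ?thesis by auto
  qed
  finally have "(\<lambda>n. ennreal (1 / c) * emeasure lborel (B \<inter> {real (Suc n)..})) \<longlonglongrightarrow> ennreal (1 / c) * 0"
    by (intro ennreal_tendsto_cmult) auto
  moreover have "emeasure M ?E \<le> ennreal (1 / c) * emeasure lborel (B \<inter> {real (Suc n)..})" for n
    using E by (intro order_trans[OF emeasure_mono V_law_le[OF pos c B]]) auto
  ultimately have "emeasure M ?E \<le> 0" by (intro LIMSEQ_le_const) auto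
  moreover have "?E \<in> sets M" using E by auto
  ultimately have "?E \<in> null_sets M" by (auto simp: null_sets_def)
  then have "AE \<omega> in M. \<omega> \<notin> ?E" by (rule AE_not_in)
  moreover have "AE \<omega> in M. \<forall>n. real (Suc n) \<le> V (real (Suc n)) c \<omega> \<and> X (enn2real (T (real (Suc n)) c \<omega>)) \<omega> = c"
    unfolding AE_all_countable using AE_V[OF pos c] by (auto elim: AE_mp)
  ultimately show ?thesis
    using AE_space
  proof eventually_elim
    case (elim \<omega>)
    then obtain n where n: "V (real (Suc n)) c \<omega> \<notin> B" by auto
    have "0 \<le> V (real (Suc n)) c \<omega>" using elim(2) by (meson of_nat_0_le_iff order_trans)
    then show ?case
      using elim(2) n by (intro exI[of _ "enn2real (T (real (Suc n)) c \<omega>)"]) (auto simp: V_def)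
  qed
qed

end

section \<open>Consequences of the integrability of \<open>\<phi>\<close>, and the
  conclusion\<close>

section \<open>The supremum\<close>

text \<open>Markov's inequality at height 1.\<close>

lemma level_set_finite:
  fixes \<phi> :: "real \<Rightarrow> real"
  assumes meas: "set_borel_measurable borel {0..} \<phi>" and int: "set_integrable lborel {0..} \<phi>"
  shows "{x. 0 \<le> x \<and> 1 < \<phi> x} \<in> sets borel" "emeasure lborel {x. 0 \<le> x \<and> 1 < \<phi> x} < \<infinity>"
proof -
  let ?f = "\<lambda>x. indicator {0..} x * \<phi> x"
  have f: "?f \<in> borel_measurable borel" using meas by (simp add: set_borel_measurable_def)
  have eq: "{x. 0 \<le> x \<and> 1 < \<phi> x} = {x \<in> space borel. 1 < ?f x}" by (auto simp: indicator_def)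
  show 1: "{x. 0 \<le> x \<and> 1 < \<phi> x} \<in> sets borel"
    unfolding eq using f by (simp add: borel_measurable_iff_greater)
  have "emeasure lborel {x. 0 \<le> x \<and> 1 < \<phi> x} = (\<integral>\<^sup>+x. indicator {x. 0 \<le> x \<and> 1 < \<phi> x} x \<partial>lborel)"
    using 1 by simp
  also have "\<dots> \<le> (\<integral>\<^sup>+x. ennreal (norm (?f x)) \<partial>lborel)"
    by (rule nn_integral_mono) (auto simp: indicator_def)
  also have "\<dots> < \<infinity>" using int by (auto simp: set_integrable_def integrable_iff_bounded)
  finally show "emeasure lborel {x. 0 \<le> x \<and> 1 < \<phi> x} < \<infinity>" .
qed

text \<open>Off the finite-measure set \<open>?B\<close> the integrand is at least
  \<open>1 / (a + 1)\<close>, and what remains of the half-line has infinite measure.\<close>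

lemma nn_integral_inverse_eq_top:
  fixes \<phi> :: "real \<Rightarrow> real"
  assumes nonneg: "\<And>x. 0 \<le> x \<Longrightarrow> 0 \<le> \<phi> x" and a: "0 \<le> a"
    and meas: "set_borel_measurable borel {0..} \<phi>" and int: "set_integrable lborel {0..} \<phi>"
  shows "(\<integral>\<^sup>+x\<in>{0..}. 1 / ennreal (a + \<phi> x) \<partial>lborel) = \<infinity>"
proof -
  let ?B = "{x. 0 \<le> x \<and> 1 < \<phi> x}"
  note B = level_set_finite[OF meas int]
  have top: "emeasure lborel {0::real..} = \<infinity>"
  proof (cases "emeasure lborel {0::real..}")
    case (real r)
    obtain n where n: "r < real n" using reals_Archimedean2 by blast
    have "emeasure lborel {0..real n} \<le> emeasure lborel {0::real..}" by (intro emeasure_mono) auto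
    then show ?thesis using real n by simp
  qed simp
  have "emeasure lborel ({0..} - ?B) = \<infinity>"
  proof (rule ccontr)
    assume "emeasure lborel ({0..} - ?B) \<noteq> \<infinity>"
    moreover have "emeasure lborel {0::real..} \<le> emeasure lborel ({0..} - ?B) + emeasure lborel ?B"
      using B(1) by (intro order_trans[OF _ emeasure_subadditive] emeasure_mono) auto
    ultimately show False using B(2) top by (auto simp: top_unique)
  qed
  then have "\<infinity> = ennreal (1 / (a + 1)) * emeasure lborel ({0..} - ?B)"
    using a by (simp add: ennreal_mult_top)
  also have "\<dots> = (\<integral>\<^sup>+x. ennreal (1 / (a + 1)) * indicator ({0..} - ?B) x \<partial>lborel)"
    using B(1) by (subst nn_integral_cmult_indicator) auto
  also have "\<dots> \<le> (\<integral>\<^sup>+x\<in>{0..}. 1 / ennreal (a + \<phi> x) \<partial>lborel)"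
  proof (rule nn_integral_mono)
    fix x :: real
    have "ennreal (1 / (a + 1)) \<le> 1 / ennreal (a + \<phi> x)" if "0 \<le> x" "\<phi> x \<le> 1"
    \<comment> \<open>Division by 0 in \<open>ennreal\<close> gives infinity here, in accordance
      with the convention 1/0 = infinity.\<close>
    proof (cases "a + \<phi> x = 0")
      case True
      then show ?thesis by (simp add: ennreal_divide_zero)
    next
      case False
      then have "0 < a + \<phi> x" using nonneg[OF that(1)] a by simp
      then have "ennreal (1 / (a + 1)) \<le> ennreal (1 / (a + \<phi> x))"
        using that by (intro ennreal_leI divide_left_mono) auto
      also have "\<dots> = 1 / ennreal (a + \<phi> x)"
        using \<open>0 < a + \<phi> x\<close> by (subst divide_ennreal[symmetric]) auto
      finally show ?thesis .
    qed
    then show "ennreal (1 / (a + 1)) * indicator ({0..} - ?B) x \<le> 1 / ennreal (a + \<phi> x) * indicator {0..} x"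
      by (auto simp: indicator_def)
  qed
  finally show ?thesis by (simp add: top_unique)
qed

text \<open>The one-sided limits of \<open>X\<close> are those of the cadlag \<open>N\<close> plus
  those of the continuous \<open>A\<close>.\<close>

lemma sigma_class_of_class_Sigma:
  assumes "usual_filtered_space M F" and \<Sigma>: "class_Sigma M F X N A"
    and jumps: "only_negative_jumps M X" and top: "AE \<omega> in M. filterlim (\<lambda>t. A t \<omega>) at_top at_top"
  shows "sigma_class M F X N A"
proof -
  interpret usual_filtered_space M F by fact
  have AEs: "AE \<omega> in M. \<forall>t\<ge>0. 0 \<le> X t \<omega>" "AE \<omega> in M. \<forall>t\<ge>0. X t \<omega> = N t \<omega> + A t \<omega>"
    "AE \<omega> in M. cadlag (\<lambda>t. N t \<omega>) \<and> N 0 \<omega> = 0"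
    "AE \<omega> in M. continuous_on {0..} (\<lambda>t. A t \<omega>) \<and> mono_on {0..} (\<lambda>t. A t \<omega>) \<and> A 0 \<omega> = 0"
    "AE \<omega> in M. AE t in interval_measure (\<lambda>t. A (max 0 t) \<omega>). 0 \<le> t \<longrightarrow> X t \<omega> = 0"
    using \<Sigma> by (auto simp: class_Sigma_def)
  show ?thesis
  proof
    show "local_martingale M F N" "adapted F X" "adapted F A"
      using \<Sigma> by (auto simp: class_Sigma_def local_submartingale_def)
    show "AE \<omega> in M. \<forall>t\<ge>0. N t \<omega> = X t \<omega> - A t \<omega>"
      using AEs(2) by eventually_elim auto
    show "AE \<omega> in M. \<forall>t\<ge>0. ((\<lambda>s. N s \<omega>) \<longlongrightarrow> N t \<omega>) (at_right t)"
      using AEs(3) by eventually_elim (auto simp: cadlag_def)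
    show "AE \<omega> in M. reflected_path (\<lambda>t. X t \<omega>) (\<lambda>t. A t \<omega>)"
      using AEs jumps[unfolded only_negative_jumps_def] top
    proof eventually_elim
      case (elim \<omega>)
      have A_tendsto: "((\<lambda>t. A t \<omega>) \<longlongrightarrow> A t \<omega>) (at t within {0..})" if "0 \<le> t" for t
        using elim(4) that by (auto simp: continuous_on_def)
      have NX: "0 \<le> t \<Longrightarrow> N t \<omega> + A t \<omega> = X t \<omega>" for t using elim(2) by auto
      \<comment> \<open>The decomposition is known at nonnegative times only, so limits are
        transferred along neighbourhoods that stay there.\<close>
      have ev_right: "eventually (\<lambda>s. N s \<omega> + A s \<omega> = X s \<omega>) (at_right t)" if "0 \<le> t" for t
        using that by (auto intro!: NX simp: eventually_at_right_field intro: exI[of _ "t + 1"])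
      have ev_left: "eventually (\<lambda>s. N s \<omega> + A s \<omega> = X s \<omega>) (at_left t)" if "0 < t" for t
        using that by (auto intro!: NX simp: eventually_at_left_field intro: exI[of _ 0])
      show ?case
      proof
        fix t :: real
        show "0 \<le> X t \<omega>" if "0 \<le> t" using elim(1) that by auto
        show "((\<lambda>t. X t \<omega>) \<longlongrightarrow> X t \<omega>) (at_right t)" if t: "0 \<le> t"
        proof -
          have "((\<lambda>t. A t \<omega>) \<longlongrightarrow> A t \<omega>) (at_right t)"
            by (rule tendsto_within_subset[OF A_tendsto[OF t]]) (use t in auto)
          moreover have "((\<lambda>t. N t \<omega>) \<longlongrightarrow> N t \<omega>) (at_right t)"
            using elim(3) t by (auto simp: cadlag_def)
          ultimately have "((\<lambda>s. N s \<omega> + A s \<omega>) \<longlongrightarrow> N t \<omega> + A t \<omega>) (at_right t)"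
            by (intro tendsto_add)
          then show ?thesis unfolding NX[OF t] using ev_right[OF t] by (rule Lim_transform_eventually)
        qed
        show "\<exists>l. ((\<lambda>t. X t \<omega>) \<longlongrightarrow> l) (at_left t)" if t: "0 < t"
        proof -
          have "((\<lambda>t. A t \<omega>) \<longlongrightarrow> A t \<omega>) (at t within {0<..<t})"
            by (rule tendsto_within_subset[OF A_tendsto]) (use t in auto)
          then have "((\<lambda>t. A t \<omega>) \<longlongrightarrow> A t \<omega>) (at_left t)"
            using at_within_nhd[of t "{0<..}" "{0<..<t}" "{..<t}"] t by (simp add: Int_commute greaterThanLessThan_def)
          moreover obtain l where "((\<lambda>t. N t \<omega>) \<longlongrightarrow> l) (at_left t)"
            using elim(3) t by (auto simp: cadlag_def)
          ultimately have "((\<lambda>s. N s \<omega> + A s \<omega>) \<longlongrightarrow> l + A t \<omega>) (at_left t)"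
            by (intro tendsto_add)
          then show ?thesis using ev_left[OF t] by (blast intro: Lim_transform_eventually)
        qed
        show "X t \<omega> \<le> Lim (at_left t) (\<lambda>t. X t \<omega>)" if "0 < t" using elim(6) that by auto
      qed (use elim in auto)
    qed
  qed
qed

theorem corollary3p11:
  fixes M :: "'a measure" and F :: "ennreal \<Rightarrow> 'a measure"
    and X N A :: "real \<Rightarrow> 'a \<Rightarrow> real" and \<phi> :: "real \<Rightarrow> real"
  assumes "usual_filtered_space M F"
    and "class_Sigma M F X N A"
    and "only_negative_jumps M X"
    and "AE \<omega> in M. filterlim (\<lambda>t. A t \<omega>) at_top at_top"
    and "\<And>x. 0 \<le> x \<Longrightarrow> 0 \<le> \<phi> x"
    and "set_borel_measurable borel {0..} \<phi>"
    and "set_integrable lborel {0..} \<phi>"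
  shows "S_phi \<phi> X A \<in> borel_measurable M \<and>
    (\<forall>a\<ge>0. measure M {\<omega> \<in> space M. S_phi \<phi> X A \<omega> > ereal a} =
      1 - exp_minus (\<integral>\<^sup>+x\<in>{0..}. 1 / ennreal (a + \<phi> x) \<partial>lborel))"
proof -
  interpret sigma_class M F X N A
    using assms(1-4) by (rule sigma_class_of_class_Sigma)
  have gt: "AE \<omega> in M. ereal (real k) < S_phi \<phi> X A \<omega>" for k
  proof -
    \<comment> \<open>The level \<open>k + 2\<close> is positive also for \<open>k = 0\<close> and,
      after subtracting at most 1, still exceeds \<open>k\<close> strictly.\<close>
    have "AE \<omega> in M. \<exists>t\<ge>0. X t \<omega> = real k + 2 \<and> 0 \<le> A t \<omega> \<and> A t \<omega> \<notin> {x. 0 \<le> x \<and> 1 < \<phi> x}"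
      using level_set_finite[OF assms(6,7)] by (intro AE_exceeds) auto
    then show ?thesis
    proof eventually_elim
      case (elim \<omega>)
      then obtain t where t: "0 \<le> t" "X t \<omega> = real k + 2" "\<phi> (A t \<omega>) \<le> 1" by auto
      have "ereal (real k) < ereal (X t \<omega> - \<phi> (A t \<omega>))" using t by simp
      also have "\<dots> \<le> S_phi \<phi> X A \<omega>" unfolding S_phi_def using t(1) by (intro SUP_upper) auto
      finally show ?case .
    qed
  qed
  have top: "AE \<omega> in M. S_phi \<phi> X A \<omega> = \<infinity>"
  proof -
    have "AE \<omega> in M. \<forall>k. ereal (real k) < S_phi \<phi> X A \<omega>"
      using gt by (simp add: AE_all_countable)
    then show ?thesis
    proof eventually_elim
      case (elim \<omega>)
      show ?case
      proof (cases "S_phi \<phi> X A \<omega>")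
        case (real r)
        moreover obtain k where "r < real k" using reals_Archimedean2 by blast
        ultimately show ?thesis using elim[rule_format, of k] by auto
      qed (use elim in auto)
    qed
  qed
  \<comment> \<open>The supremum over uncountably many times is measurable because it is almost
    surely the constant infinity on a complete space.\<close>
  have meas: "S_phi \<phi> X A \<in> borel_measurable M"
    by (rule measurable_AE_cong[OF _ top]) auto
  moreover have "measure M {\<omega> \<in> space M. S_phi \<phi> X A \<omega> > ereal a} =
      1 - exp_minus (\<integral>\<^sup>+x\<in>{0..}. 1 / ennreal (a + \<phi> x) \<partial>lborel)" if a: "0 \<le> a" for a
  proof -
    have "AE \<omega> in M. S_phi \<phi> X A \<omega> > ereal a" using top by eventually_elim simp
    then have "measure M {\<omega> \<in> space M. S_phi \<phi> X A \<omega> > ereal a} = 1"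
      using meas by (subst prob_Collect_eq_1) auto
    moreover have "(\<integral>\<^sup>+x\<in>{0..}. 1 / ennreal (a + \<phi> x) \<partial>lborel) = \<infinity>"
      using assms(5) a assms(6,7) by (rule nn_integral_inverse_eq_top)
    ultimately show ?thesis by (simp add: exp_minus_def)
  qed
  ultimately show ?thesis by blast
qed

end
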